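(* Let $p\in(1,\infty)$. There exists a constant $C=C(p)$, depending only on $p$, such that for every finite Blaschke product $B$ of degree $n$ and every $g\in H^p$, $$\int_{\mathbb{D}} |B'(z) g(z)|\,\mathrm{d}\mathcal{A}(z) \le C \sqrt{\log (n+1)}\,\|g\|_{H^{p}}.$$
   Context: $\mathbb{D}$ is the open unit disc in $\mathbb{C}$, $\mathcal{A}$ is the area (planar Lebesgue) measure, and $H^p$ is the standard Hardy space in $\mathbb{D}$ with norm $\|\cdot\|_{H^p}$. *)

theory Defs
  imports "HOL-Complex_Analysis.Complex_Analysis"
begin

text \<open>
  Functions on the unit disc are represented by functions on all of \<open>complex\<close>; every notion
  below depends only on the values on \<open>ball 0 1\<close>.
\<close>

definition finite_blaschke :: "nat \<Rightarrow> (complex \<Rightarrow> complex) \<Rightarrow> bool" where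
  "finite_blaschke n B \<longleftrightarrow>
     (\<exists>c a. norm c = 1 \<and> (\<forall>k<n. norm (a k) < 1) \<and>
        (\<forall>z\<in>ball 0 1. B z = c * (\<Prod>k<n. (z - a k) / (1 - cnj (a k) * z))))"

text \<open>
  The integrals over circles are normalised to total mass \<open>1\<close>. For functions holomorphic on the
  disc the integrand is continuous, so the Bochner integral below is a genuine integral.
\<close>

definition hardy_mean :: "real \<Rightarrow> (complex \<Rightarrow> complex) \<Rightarrow> real \<Rightarrow> real" where
  "hardy_mean p g r =
     (1 / (2 * pi) * (LINT t:{0..2*pi}|lborel. norm (g (of_real r * cis t)) powr p)) powr (1 / p)"

definition hardy_space :: "real \<Rightarrow> (complex \<Rightarrow> complex) set" where
  "hardy_space p = {g. g holomorphic_on ball 0 1 \<and> bdd_above (hardy_mean p g ` {0..<1})}"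

definition hardy_norm :: "real \<Rightarrow> (complex \<Rightarrow> complex) \<Rightarrow> real" where
  "hardy_norm p g = (SUP r\<in>{0..<1}. hardy_mean p g r)"

end

theory Submission
  imports Defs
begin

text \<open>
  Let \<open>q = min p 2\<close> and \<open>L = ln (n + 1)\<close>, and normalise \<open>g\<close>; split the disc at radius \<open>1 - 1/n\<close>.

  On the inner disc, \<open>|B' g|\<close> is the product of \<open>|B'| |g|\<^bsup>q/2\<^esup> d\<^bsup>1/2\<^esup>\<close> and
  \<open>|g|\<^bsup>1-q/2\<^esup> d\<^bsup>-1/2\<^esup>\<close>, where \<open>d\<close> is the distance to a circle of radius slightly below \<open>1\<close>.
  The square of the second factor has integral \<open>O(L)\<close>. The square of the first has bounded integral,
  because \<open>|B'|\<^sup>2 d\<close> is a Carleson measure: for \<open>q = 2\<close> write \<open>B' g = (B g)' - B g'\<close> and compare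
  power series coefficients; for \<open>q < 2\<close> divide out the zeros of \<open>g\<close> by Blaschke factors and use
  \<open>g\<^bsup>q/2\<^esup>\<close>.

  On the outer annulus, \<open>|B'| \<le> 4 / (1 - |z|)\<close> and the mean of \<open>|B'|\<close> over circles is at most \<open>n\<close>.
  Interpolating between the two bounds, the mean of \<open>|B' g|\<close> over the circle of radius \<open>r\<close> is
  \<open>O(n\<^bsup>1-1/q\<^esup> (1 - r)\<^bsup>-1/q\<^esup>)\<close>, whose integral over the annulus is \<open>O(1)\<close>.
\<close>

section \<open>Polar coordinates\<close>

text \<open>The bound \<open>|B'| \<le> 4 / (1 - |z|)\<close> together with bounded circle means of
  \<open>|g|\<close> yields only \<open>O(L)\<close> on the inner disc. The square root comes from
  pairing a factor of bounded square integral with one of square integral \<open>O(L)\<close>.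

  Boundary values of \<open>g\<close> never occur, because every circle used has radius below 1. On
  a closed disc of radius \<open>\<rho> < 1\<close> a nonzero \<open>g\<close> has finitely many
  zeros, so finitely many Blaschke factors remove them. The price is the weight
  \<open>\<rho> - |z|\<close> in place of \<open>1 - |z|\<close>; hence \<open>\<rho>\<close> sits
  strictly between the split radius and 1, with gaps of order \<open>1 / n\<close> that cost only a
  constant in the logarithm.

  The choice of \<open>q\<close> answers several demands. \<open>q \<le> p\<close> lets the norm
  control the means of \<open>|g|\<close> to the power \<open>q\<close>; \<open>q \<le> 2\<close>
  makes the remaining exponent \<open>2 - q\<close> nonnegative, and \<open>q \<ge> 1\<close> keeps
  it at most \<open>q\<close>. Finally \<open>q > 1\<close> makes \<open>(1 - r)\<close> to the
  power \<open>-1/q\<close> integrable at the boundary: this is where \<open>p > 1\<close> enters,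
  and it is the origin of \<open>1 - 1/q\<close> in the denominator of the constant.\<close>

lemma nn_integral_lborel_shift:
  fixes f :: "'a::euclidean_space \<Rightarrow> ennreal"
  assumes [measurable]: "f \<in> borel_measurable borel"
  shows "(\<integral>\<^sup>+x. f (a + x) \<partial>lborel) = (\<integral>\<^sup>+x. f x \<partial>lborel)"
proof -
  have "(\<integral>\<^sup>+x. f x \<partial>lborel) = (\<integral>\<^sup>+x. f x \<partial>distr lborel borel ((+) a))"
    by (simp add: lborel_distr_plus)
  then show ?thesis
    by (simp add: nn_integral_distr)
qed

lemma nn_integral_lborel_uminus:
  fixes f :: "'a::euclidean_space \<Rightarrow> ennreal"
  assumes [measurable]: "f \<in> borel_measurable borel"
  shows "(\<integral>\<^sup>+x. f (- x) \<partial>lborel) = (\<integral>\<^sup>+x. f x \<partial>lborel)"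
proof -
  have "(\<integral>\<^sup>+x. f x \<partial>lborel) = (\<integral>\<^sup>+x. f x \<partial>distr lborel borel (\<lambda>x::'a. - x))"
    using lborel_affine[of "-1" "0::'a"] by (simp add: density_1)
  then show ?thesis
    by (simp add: nn_integral_distr)
qed

lemma nn_integral_lborel_reflect:
  fixes f :: "'a::euclidean_space \<Rightarrow> ennreal"
  assumes [measurable]: "f \<in> borel_measurable borel"
  shows "(\<integral>\<^sup>+x. f (a - x) \<partial>lborel) = (\<integral>\<^sup>+x. f x \<partial>lborel)"
  using nn_integral_lborel_uminus[of "\<lambda>x. f (a + x)"] nn_integral_lborel_shift[of f a] by simp

text \<open>Uniqueness of Haar measure, specialised: convolve with the indicator of the unit disc, which
  the rotation preserves.\<close>

lemma nn_integral_lborel_rotate: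
  fixes f :: "complex \<Rightarrow> ennreal"
  assumes [measurable]: "f \<in> borel_measurable borel" and c: "norm c = 1"
  shows "(\<integral>\<^sup>+z. f (c * z) \<partial>lborel) = (\<integral>\<^sup>+z. f z \<partial>lborel)"
proof -
  define K :: "complex \<Rightarrow> ennreal" where "K = indicator (ball 0 1)"
  have [measurable]: "K \<in> borel_measurable borel"
    unfolding K_def by (intro borel_measurable_indicator) auto
  have c0: "c \<noteq> 0"
    using c by auto
  have K_int: "(\<integral>\<^sup>+z. K z \<partial>lborel) = ennreal pi"
    unfolding K_def using emeasure_ball[of 1 "0::complex"] by (simp add: unit_ball_vol_2)
  have K_rot: "K (y - c * x) = K (y / c - x)" for x y
  proof -
    have "norm (y - c * x) = norm (c * (y / c - x))"
      using c0 by (simp add: algebra_simps)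
    then show ?thesis
      using c by (simp add: K_def indicator_def norm_mult)
  qed
  \<comment> \<open>Adding \<open>y\<close> inside \<open>f\<close> amounts to translating
    \<open>x\<close> by \<open>y / c\<close>, so this integral does not depend on \<open>y\<close>.
    Weighting by \<open>K\<close> therefore contributes the factor \<open>pi\<close> here, and by
    \<open>K_rot\<close> it does so again at the other end of the chain.\<close>
  have inner: "(\<integral>\<^sup>+x. f (c * x + y) \<partial>lborel) = (\<integral>\<^sup>+x. f (c * x) \<partial>lborel)" for y
    using nn_integral_lborel_shift[of "\<lambda>x. f (c * x)" "y / c"] c0 by (simp add: algebra_simps)
  have "ennreal pi * (\<integral>\<^sup>+x. f (c * x) \<partial>lborel) = (\<integral>\<^sup>+y. K y * (\<integral>\<^sup>+x. f (c * x + y) \<partial>lborel) \<partial>lborel)"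
    by (simp add: inner nn_integral_multc K_int)
  also have "\<dots> = (\<integral>\<^sup>+y. (\<integral>\<^sup>+x. K y * f (c * x + y) \<partial>lborel) \<partial>lborel)"
    by (intro nn_integral_cong nn_integral_cmult[symmetric]) measurable
  also have "\<dots> = (\<integral>\<^sup>+x. (\<integral>\<^sup>+y. K y * f (c * x + y) \<partial>lborel) \<partial>lborel)"
    by (rule lborel_pair.Fubini') measurable
  also have "\<dots> = (\<integral>\<^sup>+x. (\<integral>\<^sup>+y. K (y - c * x) * f y \<partial>lborel) \<partial>lborel)"
  proof (rule nn_integral_cong)
    fix x
    show "(\<integral>\<^sup>+y. K y * f (c * x + y) \<partial>lborel) = (\<integral>\<^sup>+y. K (y - c * x) * f y \<partial>lborel)"
      using nn_integral_lborel_shift[of "\<lambda>y. K (y - c * x) * f y" "c * x"] by simp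
  qed
  also have "\<dots> = (\<integral>\<^sup>+y. (\<integral>\<^sup>+x. K (y - c * x) * f y \<partial>lborel) \<partial>lborel)"
    by (rule lborel_pair.Fubini') measurable
  also have "\<dots> = (\<integral>\<^sup>+y. (\<integral>\<^sup>+x. K (y / c - x) \<partial>lborel) * f y \<partial>lborel)"
    unfolding K_rot by (intro nn_integral_cong nn_integral_multc) measurable
  also have "\<dots> = ennreal pi * (\<integral>\<^sup>+y. f y \<partial>lborel)"
    by (simp add: nn_integral_lborel_reflect K_int nn_integral_cmult)
  finally show ?thesis
    by (simp add: ennreal_mult_cancel_left)
qed

text \<open>The disc of radius \<open>a\<close> has area \<open>pi * a^2\<close>, with derivative
  \<open>2 * pi * a\<close>. Agreement on half-lines suffices: they generate the Borel sets, are
  stable under intersection, and have finite measure here.\<close>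

lemma distr_lborel_norm_complex:
  "distr lborel borel (norm :: complex \<Rightarrow> real) = density lborel (\<lambda>r. ennreal (2 * pi * r) * indicator {0..} r)"
proof (rule measure_eqI_generator_eq[where E = "range atMost" and A = "\<lambda>i. {..real i}" and \<Omega> = UNIV])
  show "Int_stable (range (atMost :: real \<Rightarrow> real set))"
  proof (rule Int_stableI)
    fix a b assume "a \<in> range (atMost :: real \<Rightarrow> real set)" "b \<in> range (atMost :: real \<Rightarrow> real set)"
    then obtain x y where "a = {..x}" "b = {..y}" by auto
    then have "a \<inter> b = {..min x y}" by auto
    then show "a \<inter> b \<in> range atMost" by auto
  qed
  have em: "emeasure (distr lborel borel (norm :: complex \<Rightarrow> real)) {..a} = (if a < 0 then 0 else ennreal (pi * a\<^sup>2))" for a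
  proof -
    have "emeasure (distr lborel borel (norm :: complex \<Rightarrow> real)) {..a} = emeasure lborel (norm -` {..a} :: complex set)"
      by (subst emeasure_distr) auto
    also have "(norm -` {..a} :: complex set) = (if a < 0 then {} else cball 0 a)"
      by (auto dest: order_trans[OF norm_ge_zero])
    finally show ?thesis
      using emeasure_cball[of a "0::complex"] by (auto simp: unit_ball_vol_2)
  qed
  show "emeasure (distr lborel borel (norm :: complex \<Rightarrow> real)) X
      = emeasure (density lborel (\<lambda>r. ennreal (2 * pi * r) * indicator {0..} r)) X" if "X \<in> range atMost" for X
  proof -
    from that obtain a where X: "X = {..a}" by auto
    have "emeasure (density lborel (\<lambda>r. ennreal (2 * pi * r) * indicator {0..} r)) X
        = (\<integral>\<^sup>+r. ennreal (2 * pi * r) * indicator {0..a} r \<partial>lborel)"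
      unfolding X by (subst emeasure_density) (auto intro!: nn_integral_cong split: split_indicator)
    also have "\<dots> = (if a < 0 then 0 else ennreal (pi * a\<^sup>2))"
    proof (cases "a < 0")
      case False
      then have "(\<integral>\<^sup>+r. ennreal (2 * pi * r) * indicator {0..a} r \<partial>lborel) = ennreal (pi * a\<^sup>2 - pi * 0\<^sup>2)"
        by (intro nn_integral_FTC_Icc) (auto intro!: derivative_eq_intros)
      with False show ?thesis by simp
    qed simp
    finally show ?thesis
      by (simp add: em X)
  qed
  show "(\<Union>i. {..real i}) = UNIV"
    by (auto intro: real_arch_simple)
  show "emeasure (distr lborel borel (norm :: complex \<Rightarrow> real)) {..real i} \<noteq> \<infinity>" for i
    by (simp add: em)
  show "sets (distr lborel borel (norm :: complex \<Rightarrow> real)) = sigma_sets UNIV (range atMost)"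
    "sets (density lborel (\<lambda>r. ennreal (2 * pi * r) * indicator {0..} r)) = sigma_sets UNIV (range atMost)"
    by (simp_all add: borel_eq_atMost)
qed auto

section \<open>Circle integrals and polar coordinates\<close>

text \<open>The window \<open>{s..s+T}\<close> is cut at \<open>T\<close> and the part beyond is
  moved back by one period; endpoints of the pieces are null sets.\<close>

lemma nn_integral_periodic_shift:
  fixes f :: "real \<Rightarrow> ennreal"
  assumes [measurable]: "f \<in> borel_measurable borel"
    and per: "\<And>x. f (x + T) = f x" and s: "0 \<le> s" "s \<le> T"
  shows "(\<integral>\<^sup>+t\<in>{0..T}. f (s + t) \<partial>lborel) = (\<integral>\<^sup>+t\<in>{0..T}. f t \<partial>lborel)"
proof -
  have "(\<integral>\<^sup>+t\<in>{0..T}. f (s + t) \<partial>lborel) = (\<integral>\<^sup>+t\<in>{s..s+T}. f t \<partial>lborel)"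
    using nn_integral_lborel_shift[of "\<lambda>t. f t * indicator {s..s+T} t" s]
    by (simp add: indicator_def)
  also have "\<dots> = (\<integral>\<^sup>+t. f t * indicator {s..T} t + f t * indicator {T<..s+T} t \<partial>lborel)"
    using s by (intro nn_integral_cong) (auto split: split_indicator)
  also have "\<dots> = (\<integral>\<^sup>+t\<in>{s..T}. f t \<partial>lborel) + (\<integral>\<^sup>+t\<in>{T<..s+T}. f t \<partial>lborel)"
    by (rule nn_integral_add) measurable
  also have "(\<integral>\<^sup>+t\<in>{T<..s+T}. f t \<partial>lborel) = (\<integral>\<^sup>+t\<in>{0<..s}. f t \<partial>lborel)"
    using nn_integral_lborel_shift[of "\<lambda>t. f t * indicator {T<..s+T} t" T] per
    by (simp add: indicator_def add.commute)
  also have "\<dots> = (\<integral>\<^sup>+t\<in>{0..<s}. f t \<partial>lborel)"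
  proof (rule nn_integral_cong_AE)
    show "AE t in lborel. f t * indicator {0<..s} t = f t * indicator {0..<s} t"
      using AE_lborel_singleton[of "0::real"] AE_lborel_singleton[of s]
      by eventually_elim (auto split: split_indicator)
  qed
  also have "(\<integral>\<^sup>+t\<in>{s..T}. f t \<partial>lborel) + \<dots> = (\<integral>\<^sup>+t. f t * indicator {s..T} t + f t * indicator {0..<s} t \<partial>lborel)"
    by (rule nn_integral_add[symmetric]) measurable
  also have "\<dots> = (\<integral>\<^sup>+t\<in>{0..T}. f t \<partial>lborel)"
    using s by (intro nn_integral_cong) (auto split: split_indicator)
  finally show ?thesis .
qed

text \<open>Not normalised, unlike \<open>hardy_mean\<close>, so a factor \<open>2 * pi\<close>
  accompanies every mean. Values in \<open>ennreal\<close> allow Tonelli and monotonicity without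
  integrability conditions.\<close>

definition circle_integral :: "(complex \<Rightarrow> ennreal) \<Rightarrow> real \<Rightarrow> ennreal" where
  "circle_integral F r = (\<integral>\<^sup>+t\<in>{0..2*pi}. F (of_real r * cis t) \<partial>lborel)"

lemma measurable_cis [measurable]: "cis \<in> borel_measurable borel"
  by (intro borel_measurable_continuous_onI continuous_on_cis continuous_on_id)

lemma measurable_circle_integral [measurable]:
  assumes [measurable]: "F \<in> borel_measurable borel"
  shows "circle_integral F \<in> borel_measurable borel"
  unfolding circle_integral_def by measurable

lemma circle_integral_rotate:
  assumes [measurable]: "F \<in> borel_measurable borel"
  shows "(\<integral>\<^sup>+t\<in>{0..2*pi}. F (cis t * z) \<partial>lborel) = circle_integral F (norm z)"
proof -
  have z: "z = of_real (norm z) * cis (Arg2pi z)"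
    by (metis Arg2pi_eq cis_conv_exp)
  have "(\<integral>\<^sup>+t\<in>{0..2*pi}. F (of_real (norm z) * cis (Arg2pi z + t)) \<partial>lborel) = circle_integral F (norm z)"
    unfolding circle_integral_def
    by (rule nn_integral_periodic_shift) (auto simp: Arg2pi_ge_0 Arg2pi_lt_2pi less_imp_le simp flip: cis_mult)
  moreover have "cis t * z = of_real (norm z) * cis (Arg2pi z + t)" for t
    by (subst z) (simp add: cis_mult [symmetric] mult_ac)
  ultimately show ?thesis
    by simp
qed

text \<open>No change of variables is needed: by rotation invariance the area integral equals its
  average over all rotations, and after Fubini the inner integral depends on \<open>norm z\<close>
  alone, whose distribution is known.\<close>

lemma nn_integral_polar:
  assumes [measurable]: "F \<in> borel_measurable borel"
  shows "(\<integral>\<^sup>+z. F z \<partial>lborel) = (\<integral>\<^sup>+r\<in>{0..}. ennreal r * circle_integral F r \<partial>lborel)"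
proof -
  have "ennreal (2 * pi) * (\<integral>\<^sup>+z. F z \<partial>lborel) = (\<integral>\<^sup>+t. (\<integral>\<^sup>+z. F z \<partial>lborel) * indicator {0..2*pi} t \<partial>lborel)"
    by (subst nn_integral_cmult_indicator) (auto simp: mult.commute)
  also have "\<dots> = (\<integral>\<^sup>+t. (\<integral>\<^sup>+z. F (cis t * z) * indicator {0..2*pi} t \<partial>lborel) \<partial>lborel)"
    by (intro nn_integral_cong) (simp add: nn_integral_multc nn_integral_lborel_rotate)
  also have "\<dots> = (\<integral>\<^sup>+z. (\<integral>\<^sup>+t. F (cis t * z) * indicator {0..2*pi} t \<partial>lborel) \<partial>lborel)"
    by (rule lborel_pair.Fubini') measurable
  also have "\<dots> = (\<integral>\<^sup>+z. circle_integral F (norm (z::complex)) \<partial>lborel)"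
    by (simp add: circle_integral_rotate)
  also have "\<dots> = (\<integral>\<^sup>+r. circle_integral F r \<partial>distr lborel borel (norm :: complex \<Rightarrow> real))"
    by (simp add: nn_integral_distr)
  also have "\<dots> = (\<integral>\<^sup>+r. ennreal (2 * pi * r) * indicator {0..} r * circle_integral F r \<partial>lborel)"
    unfolding distr_lborel_norm_complex by (rule nn_integral_density) measurable
  also have "\<dots> = (\<integral>\<^sup>+r. ennreal (2 * pi) * (ennreal r * circle_integral F r * indicator {0..} r) \<partial>lborel)"
    by (intro nn_integral_cong) (auto simp: ennreal_mult mult_ac split: split_indicator)
  also have "\<dots> = ennreal (2 * pi) * (\<integral>\<^sup>+r\<in>{0..}. ennreal r * circle_integral F r \<partial>lborel)"
    by (rule nn_integral_cmult) measurable
  finally show ?thesis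
    by (simp add: ennreal_mult_cancel_left)
qed

section \<open>Parseval's identity on circles\<close>

lemma has_integral_cis_multiple:
  fixes m :: int
  shows "((\<lambda>t. cis (of_int m * t)) has_integral (if m = 0 then of_real (2 * pi) else 0)) {0..2*pi}"
proof (cases "m = 0")
  case True
  then show ?thesis
    using has_integral_const_real[of "1::complex" 0 "2*pi"] by (simp add: scaleR_conv_of_real)
next
  case False
  have "((\<lambda>t. cis (of_int m * t) / (\<i> * of_int m)) has_vector_derivative cis (of_int m * t)) (at t within {0..2*pi})" for t
  proof -
    have "((\<lambda>z. exp (\<i> * of_int m * z) / (\<i> * of_int m)) has_field_derivative exp (\<i> * of_int m * of_real t)) (at (of_real t))"
      using False by (auto intro!: derivative_eq_intros)
    from has_vector_derivative_real_field[OF this] show ?thesis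
      by (auto simp: cis_conv_exp mult_ac)
  qed
  then have "((\<lambda>t. cis (of_int m * t)) has_integral cis (of_int m * (2 * pi)) / (\<i> * of_int m) - cis (of_int m * 0) / (\<i> * of_int m)) {0..2*pi}"
    by (intro fundamental_theorem_of_calculus) auto
  moreover have "cis (of_int m * (2 * pi)) = 1"
    by (metis cis_multiple_2pi Ints_of_int mult.commute)
  ultimately show ?thesis
    using False by simp
qed

lemma nn_integral_interval_has_integral:
  fixes f :: "real \<Rightarrow> real"
  assumes [measurable]: "f \<in> borel_measurable borel"
    and "\<And>x. x \<in> {a..b} \<Longrightarrow> 0 \<le> f x" "(f has_integral I) {a..b}"
  shows "(\<integral>\<^sup>+x\<in>{a..b}. ennreal (f x) \<partial>lborel) = ennreal I"
proof -
  have "(\<integral>\<^sup>+x. ennreal (indicator {a..b} x * f x) \<partial>lborel) = ennreal I"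
  proof (rule nn_integral_has_integral_lborel)
    show "(\<lambda>x. indicator {a..b} x * f x) \<in> borel_measurable borel"
      by measurable
    show "((\<lambda>x. indicator {a..b} x * f x) has_integral I) UNIV"
      using assms(3) has_integral_restrict_UNIV[of "{a..b}" f I]
      by (simp add: indicator_def of_bool_def if_distrib[of "\<lambda>x. x * _"] cong: if_cong)
  qed (use assms(2) in \<open>auto simp: indicator_def\<close>)
  moreover have "(\<integral>\<^sup>+x\<in>{a..b}. ennreal (f x) \<partial>lborel) = (\<integral>\<^sup>+x. ennreal (indicator {a..b} x * f x) \<partial>lborel)"
    by (intro nn_integral_cong) (auto split: split_indicator)
  ultimately show ?thesis
    by simp
qed

text \<open>Adding the frequency \<open>N\<close> to a polynomial of lower frequencies creates cross
  terms of frequencies \<open>k - N\<close>, all nonzero, which integrate to 0.\<close>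

lemma has_integral_trig_poly_norm_sq:
  fixes a :: "nat \<Rightarrow> complex"
  shows "((\<lambda>t. (norm (\<Sum>k<N. a k * cis (real k * t)))\<^sup>2) has_integral (\<Sum>k<N. 2 * pi * (norm (a k))\<^sup>2)) {0..2*pi}"
proof (induction N)
  case (Suc N)
  define S where "S t = (\<Sum>k<N. a k * cis (real k * t))" for t
  have "((\<lambda>t. \<Sum>k<N. a k * cnj (a N) * cis (of_int (int k - int N) * t)) has_integral (\<Sum>k<N. a k * cnj (a N) * 0)) {0..2*pi}"
  proof (intro has_integral_sum has_integral_mult_right)
    fix k assume "k \<in> {..<N}"
    then show "((\<lambda>t. cis (of_int (int k - int N) * t)) has_integral 0) {0..2*pi}"
      using has_integral_cis_multiple[of "int k - int N"] by auto
  qed auto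
  moreover have "(\<Sum>k<N. a k * cnj (a N) * cis (of_int (int k - int N) * t)) = S t * cnj (a N * cis (real N * t))" for t
    unfolding S_def sum_distrib_right
    by (intro sum.cong) (auto simp: cis_cnj cis_mult algebra_simps)
  ultimately have "((\<lambda>t. S t * cnj (a N * cis (real N * t))) has_integral 0) {0..2*pi}"
    by simp
  from has_integral_Re[OF this]
  have cross: "((\<lambda>t. Re (S t * cnj (a N * cis (real N * t)))) has_integral 0) {0..2*pi}"
    by simp
  have const: "((\<lambda>t. (norm (a N))\<^sup>2) has_integral (2 * pi * (norm (a N))\<^sup>2)) {0..2*pi}"
    using has_integral_const_real[of "(norm (a N))\<^sup>2" 0 "2*pi"] by simp
  have exp: "(norm (x + y))\<^sup>2 = (norm x)\<^sup>2 + (norm y)\<^sup>2 + 2 * Re (x * cnj y)" for x y :: complex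
    unfolding cmod_power2 by (simp add: power2_eq_square algebra_simps)
  have "((\<lambda>t. (norm (S t))\<^sup>2 + (norm (a N))\<^sup>2 + 2 * Re (S t * cnj (a N * cis (real N * t)))) has_integral
      (\<Sum>k<N. 2 * pi * (norm (a k))\<^sup>2) + 2 * pi * (norm (a N))\<^sup>2 + 2 * 0) {0..2*pi}"
    using Suc.IH unfolding S_def[symmetric]
    by (intro has_integral_add has_integral_mult_right cross const)
  also have "(\<lambda>t. (norm (S t))\<^sup>2 + (norm (a N))\<^sup>2 + 2 * Re (S t * cnj (a N * cis (real N * t))))
      = (\<lambda>t. (norm (\<Sum>k<Suc N. a k * cis (real k * t)))\<^sup>2)"
    by (simp add: exp norm_mult S_def)
  finally show ?case
    by simp
qed simp

text \<open>The identity passes from partial sums to the limit by dominated convergence: strictly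
  inside the disc of convergence the series converges absolutely, which bounds all partial sums on
  the circle by one constant.\<close>

lemma parseval_circle:
  fixes c :: "nat \<Rightarrow> complex"
  assumes sums: "\<And>z. z \<in> ball 0 R \<Longrightarrow> (\<lambda>k. c k * z ^ k) sums u z" and r: "0 \<le> r" "r < R"
  shows "circle_integral (\<lambda>z. ennreal ((norm (u z))\<^sup>2)) r = (\<Sum>k. ennreal (2 * pi * (norm (c k))\<^sup>2 * r ^ (2 * k)))"
proof -
  define a where "a k = c k * of_real r ^ k" for k
  define S where "S N t = (\<Sum>k<N. a k * cis (real k * t))" for N t
  obtain R' where R': "r < R'" "R' < R"
    using r dense by blast
  have "summable (\<lambda>k. c k * of_real R' ^ k)"
    using sums[of "of_real R'"] R' r by (auto simp: sums_iff)
  then have "summable (\<lambda>k. norm (c k * of_real r ^ k))"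
    using R' r by (intro powser_insidea) auto
  then have summ: "summable (\<lambda>k. norm (a k))"
    by (simp add: a_def)
  define A where "A = (\<Sum>k. norm (a k))"
  have bound: "norm (S N t) \<le> A" for N t
  proof -
    have "norm (S N t) \<le> (\<Sum>k<N. norm (a k))"
      unfolding S_def by (rule order.trans[OF norm_sum]) (simp add: norm_mult)
    also have "\<dots> \<le> A"
      unfolding A_def by (intro sum_le_suminf summ) auto
    finally show ?thesis .
  qed
  have S_lim: "(\<lambda>N. S N t) \<longlonglongrightarrow> u (of_real r * cis t)" for t
  proof -
    have "(\<lambda>k. c k * (of_real r * cis t) ^ k) sums u (of_real r * cis t)"
      using r by (intro sums) (simp add: norm_mult)
    moreover have "c k * (of_real r * cis t) ^ k = a k * cis (real k * t)" for k
      by (simp add: a_def power_mult_distrib Complex.DeMoivre)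
    ultimately show ?thesis
      by (simp add: sums_def S_def)
  qed
  have cont: "continuous_on X (S N)" for X N
    unfolding S_def by (intro continuous_intros)
  have S_int: "(\<integral>\<^sup>+t\<in>{0..2*pi}. ennreal ((norm (S N t))\<^sup>2) \<partial>lborel) = (\<Sum>k<N. ennreal (2 * pi * (norm (a k))\<^sup>2))" for N
  proof -
    have "(\<integral>\<^sup>+t\<in>{0..2*pi}. ennreal ((norm (S N t))\<^sup>2) \<partial>lborel) = ennreal (\<Sum>k<N. 2 * pi * (norm (a k))\<^sup>2)"
      using has_integral_trig_poly_norm_sq[of a N]
      by (intro nn_integral_interval_has_integral borel_measurable_continuous_onI continuous_intros cont)
         (auto simp: S_def)
    then show ?thesis
      by simp
  qed
  have "(\<lambda>N. \<integral>\<^sup>+t\<in>{0..2*pi}. ennreal ((norm (S N t))\<^sup>2) \<partial>lborel)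
      \<longlonglongrightarrow> (\<integral>\<^sup>+t\<in>{0..2*pi}. ennreal ((norm (u (of_real r * cis t)))\<^sup>2) \<partial>lborel)"
  proof (rule nn_integral_dominated_convergence[where w = "\<lambda>t. ennreal (A\<^sup>2) * indicator {0..2*pi} t"])
    have [measurable]: "S N \<in> borel_measurable borel" for N
      using cont by (rule borel_measurable_continuous_onI)
    have [measurable]: "(\<lambda>t. u (of_real r * cis t)) \<in> borel_measurable borel"
      by (rule borel_measurable_LIMSEQ_metric[OF _ S_lim]) measurable
    show "(\<lambda>t. ennreal ((norm (S N t))\<^sup>2) * indicator {0..2*pi} t) \<in> borel_measurable lborel" for N
      by measurable
    show "(\<lambda>t. ennreal ((norm (u (of_real r * cis t)))\<^sup>2) * indicator {0..2*pi} t) \<in> borel_measurable lborel"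
      by measurable
    show "AE t in lborel. ennreal ((norm (S N t))\<^sup>2) * indicator {0..2*pi} t \<le> ennreal (A\<^sup>2) * indicator {0..2*pi} t" for N
      using bound by (intro AE_I2 mult_right_mono ennreal_leI power_mono) auto
    show "AE t in lborel. (\<lambda>N. ennreal ((norm (S N t))\<^sup>2) * indicator {0..2*pi} t)
        \<longlonglongrightarrow> ennreal ((norm (u (of_real r * cis t)))\<^sup>2) * indicator {0..2*pi} t"
    proof (rule AE_I2)
      fix t
      have "(\<lambda>N. ennreal ((norm (S N t))\<^sup>2)) \<longlonglongrightarrow> ennreal ((norm (u (of_real r * cis t)))\<^sup>2)"
        by (intro tendsto_ennrealI tendsto_intros S_lim)
      then show "(\<lambda>N. ennreal ((norm (S N t))\<^sup>2) * indicator {0..2*pi} t)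
          \<longlonglongrightarrow> ennreal ((norm (u (of_real r * cis t)))\<^sup>2) * indicator {0..2*pi} t"
        by (cases "t \<in> {0..2*pi}") auto
    qed
    show "(\<integral>\<^sup>+t. ennreal (A\<^sup>2) * indicator {0..2*pi} t \<partial>lborel) < \<infinity>"
      by (simp add: nn_integral_cmult_indicator ennreal_mult_less_top)
  qed measurable
  moreover have "(\<lambda>N. \<Sum>k<N. ennreal (2 * pi * (norm (a k))\<^sup>2)) \<longlonglongrightarrow> (\<Sum>k. ennreal (2 * pi * (norm (a k))\<^sup>2))"
    by (rule summable_LIMSEQ) auto
  ultimately have "circle_integral (\<lambda>z. ennreal ((norm (u z))\<^sup>2)) r = (\<Sum>k. ennreal (2 * pi * (norm (a k))\<^sup>2))"
    unfolding S_int circle_integral_def by (rule LIMSEQ_unique)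
  moreover have "2 * pi * (norm (a k))\<^sup>2 = 2 * pi * (norm (c k))\<^sup>2 * r ^ (2 * k)" for k
    by (simp add: a_def norm_mult norm_power power_mult_distrib power_even_eq r(1))
  ultimately show ?thesis
    by simp
qed

section \<open>The Carleson embedding\<close>

lemma nn_integral_polar_le:
  assumes [measurable]: "F \<in> borel_measurable borel"
    and "\<And>r. 0 \<le> r \<Longrightarrow> circle_integral F r \<le> \<Phi> r"
  shows "(\<integral>\<^sup>+z. F z \<partial>lborel) \<le> (\<integral>\<^sup>+r\<in>{0..}. ennreal r * \<Phi> r \<partial>lborel)"
  unfolding nn_integral_polar[OF assms(1)]
  by (intro nn_integral_mono) (auto intro!: mult_left_mono assms(2) split: split_indicator)

lemma measurable_ennreal_indicator_ball:
  fixes f :: "complex \<Rightarrow> real"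
  assumes "continuous_on (ball 0 R) f"
  shows "(\<lambda>z. ennreal (f z) * indicator (ball 0 R) z) \<in> borel_measurable borel"
proof -
  have "(\<lambda>z. indicator (ball 0 R) z *\<^sub>R f z) \<in> borel_measurable borel"
    using assms by (intro borel_measurable_continuous_on_indicator) auto
  then have "(\<lambda>z. ennreal (indicator (ball 0 R) z *\<^sub>R f z)) \<in> borel_measurable borel"
    by (rule measurable_compose) measurable
  moreover have "(\<lambda>z. ennreal (f z) * indicator (ball 0 R) z) = (\<lambda>z. ennreal (indicator (ball 0 R) z *\<^sub>R f z))"
    by (auto split: split_indicator)
  ultimately show ?thesis
    by simp
qed

text \<open>By Parseval on each circle, the left side is a sum over \<open>k\<close> of
  \<open>2 * pi * (k+1)^2 * |c (k+1)|^2\<close> times the integral of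
  \<open>r^(2k+1) * (\<rho> - r)\<close>, which is \<open>\<rho>^(2k+3) / ((2k+2)(2k+3))\<close>.
  The factor \<open>(k+1)^2\<close> from differentiation is absorbed by that denominator, leaving at
  most the Parseval sum of \<open>u\<close> itself.\<close>

lemma littlewood_paley_area:
  assumes holo: "u holomorphic_on ball 0 \<rho>" and \<rho>: "0 < \<rho>" "\<rho> \<le> 1"
    and bd: "\<And>r. 0 \<le> r \<Longrightarrow> r < \<rho> \<Longrightarrow> circle_integral (\<lambda>z. ennreal ((norm (u z))\<^sup>2)) r \<le> ennreal K" and K: "0 \<le> K"
  shows "(\<integral>\<^sup>+z\<in>ball 0 \<rho>. ennreal ((\<rho> - norm z) * (norm (deriv u z))\<^sup>2) \<partial>lborel) \<le> ennreal K"
proof -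
  define c where "c k = (deriv ^^ k) u 0 / fact k" for k
  define d where "d k = c (Suc k) * of_nat (Suc k)" for k
  have u_sums: "(\<lambda>k. c k * z ^ k) sums u z" if "z \<in> ball 0 \<rho>" for z
    using holomorphic_power_series[OF holo that] by (simp add: c_def)
  have holo': "deriv u holomorphic_on ball 0 \<rho>"
    by (intro holomorphic_deriv holo) auto
  have u'_sums: "(\<lambda>k. d k * z ^ k) sums deriv u z" if "z \<in> ball 0 \<rho>" for z
  proof -
    have "(deriv ^^ k) (deriv u) 0 / fact k = d k" for k
      by (simp add: d_def c_def funpow_Suc_right del: funpow.simps of_nat_Suc)
    then show ?thesis
      using holomorphic_power_series[OF holo' that] by simp
  qed
  have partial_less: "(\<Sum>k<n. 2 * pi * (norm (c k))\<^sup>2 * r ^ (2 * k)) \<le> K" if "0 \<le> r" "r < \<rho>" for r n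
  proof -
    have "ennreal (\<Sum>k<n. 2 * pi * (norm (c k))\<^sup>2 * r ^ (2 * k)) = (\<Sum>k<n. ennreal (2 * pi * (norm (c k))\<^sup>2 * r ^ (2 * k)))"
      using that by (intro sum_ennreal[symmetric]) auto
    also have "\<dots> \<le> (\<Sum>k. ennreal (2 * pi * (norm (c k))\<^sup>2 * r ^ (2 * k)))"
      by (intro sum_le_suminf) auto
    also have "\<dots> \<le> ennreal K"
    proof -
      have "circle_integral (\<lambda>z. ennreal ((norm (u z))\<^sup>2)) r = (\<Sum>k. ennreal (2 * pi * (norm (c k))\<^sup>2 * r ^ (2 * k)))"
        by (rule parseval_circle[OF _ that]) (rule u_sums)
      then show ?thesis
        using bd[OF that] by metis
    qed
    finally show ?thesis
      using K by (simp add: ennreal_le_iff)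
  qed
  \<comment> \<open>The hypothesis reaches only radii below \<open>\<rho>\<close>; finite sums are
    continuous in the radius, so the bound extends to \<open>\<rho>\<close>.\<close>
  have partial: "(\<Sum>k<n. 2 * pi * (norm (c k))\<^sup>2 * \<rho> ^ (2 * k)) \<le> K" for n
  proof (rule tendsto_upperbound)
    show "((\<lambda>r. \<Sum>k<n. 2 * pi * (norm (c k))\<^sup>2 * r ^ (2 * k)) \<longlongrightarrow> (\<Sum>k<n. 2 * pi * (norm (c k))\<^sup>2 * \<rho> ^ (2 * k))) (at_left \<rho>)"
      by (intro tendsto_intros)
    show "\<forall>\<^sub>F r in at_left \<rho>. (\<Sum>k<n. 2 * pi * (norm (c k))\<^sup>2 * r ^ (2 * k)) \<le> K"
      using eventually_at_left_real[OF \<rho>(1)] by eventually_elim (auto intro: partial_less)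
  qed auto
  define G where "G k r = 2 * pi * (norm (d k))\<^sup>2 * r ^ (2 * k + 1) * (\<rho> - r)" for k r
  define v where "v k = 2 * pi * (norm (d k))\<^sup>2 * (\<rho> ^ (2 * k + 3) / ((2 * real k + 2) * (2 * real k + 3)))" for k
  have G_int: "(\<integral>\<^sup>+r\<in>{0..\<rho>}. ennreal (G k r) \<partial>lborel) = ennreal (v k)" for k
  proof -
    define H where "H r = 2 * pi * (norm (d k))\<^sup>2 * (\<rho> * r ^ (2 * k + 2) / (2 * real k + 2) - r ^ (2 * k + 3) / (2 * real k + 3))" for r
    have "(H has_real_derivative G k r) (at r)" for r
      unfolding H_def G_def
      by (rule derivative_eq_intros refl | simp)+
         (simp add: add_divide_distrib [symmetric] divide_simps, simp add: algebra_simps eval_nat_numeral)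
    then have "(\<integral>\<^sup>+r\<in>{0..\<rho>}. ennreal (G k r) \<partial>lborel) = ennreal (H \<rho> - H 0)"
      using \<rho> by (intro nn_integral_FTC_Icc) (auto simp: G_def)
    also have "H \<rho> - H 0 = v k"
      unfolding H_def v_def by (simp add: divide_simps) (simp add: algebra_simps eval_nat_numeral)
    finally show ?thesis .
  qed
  have v_le: "v k \<le> 2 * pi * (norm (c (Suc k)))\<^sup>2 * \<rho> ^ (2 * Suc k)" for k
  proof -
    have "v k = 2 * pi * (norm (c (Suc k)))\<^sup>2 * \<rho> ^ (2 * Suc k) * (\<rho> * ((real k + 1)\<^sup>2 / ((2 * real k + 2) * (2 * real k + 3))))"
      by (simp add: v_def d_def norm_mult power_mult_distrib eval_nat_numeral del: of_nat_Suc) (simp add: algebra_simps)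
    also have "\<dots> \<le> 2 * pi * (norm (c (Suc k)))\<^sup>2 * \<rho> ^ (2 * Suc k) * (1 * 1)"
      using \<rho> by (intro mult_left_mono mult_mono) (auto simp: divide_simps power2_eq_square intro!: mult_mono)
    finally show ?thesis by simp
  qed
  define F where "F z = ennreal ((\<rho> - norm z) * (norm (deriv u z))\<^sup>2) * indicator (ball 0 \<rho>) z" for z
  define \<Phi> where "\<Phi> r = (\<Sum>k. ennreal ((\<rho> - r) * (2 * pi * (norm (d k))\<^sup>2 * r ^ (2 * k)))) * indicator {0..\<rho>} r" for r
  have "(\<integral>\<^sup>+z. F z \<partial>lborel) \<le> (\<integral>\<^sup>+r\<in>{0..}. ennreal r * \<Phi> r \<partial>lborel)"
  proof (rule nn_integral_polar_le)
    show "F \<in> borel_measurable borel"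
      unfolding F_def
      by (intro measurable_ennreal_indicator_ball continuous_intros holomorphic_on_imp_continuous_on holo')
    fix r :: real assume r: "0 \<le> r"
    show "circle_integral F r \<le> \<Phi> r"
    proof (cases "r < \<rho>")
      case True
      have "circle_integral F r = (\<integral>\<^sup>+t. ennreal (\<rho> - r) * (ennreal ((norm (deriv u (of_real r * cis t)))\<^sup>2) * indicator {0..2*pi} t) \<partial>lborel)"
        unfolding circle_integral_def F_def using r True
        by (intro nn_integral_cong) (auto simp: norm_mult ennreal_mult mult_ac split: split_indicator)
      also have "\<dots> = ennreal (\<rho> - r) * circle_integral (\<lambda>z. ennreal ((norm (deriv u z))\<^sup>2)) r"
      proof -
        have [measurable]: "(\<lambda>t. deriv u (of_real r * cis t)) \<in> borel_measurable borel"
          using r True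
          by (intro borel_measurable_continuous_onI continuous_on_compose2[OF holomorphic_on_imp_continuous_on[OF holo']] continuous_intros)
             (auto simp: norm_mult)
        show ?thesis
          unfolding circle_integral_def by (rule nn_integral_cmult) measurable
      qed
      also have "\<dots> = (\<Sum>k. ennreal (\<rho> - r) * ennreal (2 * pi * (norm (d k))\<^sup>2 * r ^ (2 * k)))"
      proof -
        have "circle_integral (\<lambda>z. ennreal ((norm (deriv u z))\<^sup>2)) r = (\<Sum>k. ennreal (2 * pi * (norm (d k))\<^sup>2 * r ^ (2 * k)))"
          by (rule parseval_circle[OF _ r True]) (rule u'_sums)
        then show ?thesis
          by (simp only: ennreal_suminf_cmult)
      qed
      also have "\<dots> = \<Phi> r"
        using r True by (simp add: \<Phi>_def ennreal_mult')
      finally show ?thesis by simp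
    next
      case False
      then show ?thesis
        using r by (simp add: circle_integral_def F_def norm_mult)
    qed
  qed
  also have "\<dots> = (\<integral>\<^sup>+r. (\<Sum>k. ennreal (G k r) * indicator {0..\<rho>} r) \<partial>lborel)"
  proof (rule nn_integral_cong)
    fix r
    show "ennreal r * \<Phi> r * indicator {0..} r = (\<Sum>k. ennreal (G k r) * indicator {0..\<rho>} r)"
    proof (cases "r \<in> {0..\<rho>}")
      case True
      then have "ennreal r * \<Phi> r = (\<Sum>k. ennreal r * ennreal ((\<rho> - r) * (2 * pi * (norm (d k))\<^sup>2 * r ^ (2 * k))))"
        by (simp add: \<Phi>_def)
      also have "\<dots> = (\<Sum>k. ennreal (G k r))"
        using True by (intro suminf_cong) (simp add: G_def mult_ac flip: ennreal_mult)
      finally show ?thesis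
        using True by simp
    qed (auto simp: \<Phi>_def)
  qed
  also have "\<dots> = (\<Sum>k. ennreal (v k))"
    unfolding G_int[symmetric] by (rule nn_integral_suminf) (auto simp: G_def)
  also have "\<dots> \<le> ennreal K"
  proof (rule suminf_le_const)
    fix n
    have "(\<Sum>k<n. ennreal (v k)) = ennreal (\<Sum>k<n. v k)"
      using \<rho> by (intro sum_ennreal) (auto simp: v_def)
    also have "(\<Sum>k<n. v k) \<le> (\<Sum>k<n. 2 * pi * (norm (c (Suc k)))\<^sup>2 * \<rho> ^ (2 * Suc k))"
      by (intro sum_mono v_le)
    \<comment> \<open>The derivative does not see \<open>c 0\<close>; restoring its nonnegative term
      turns the shifted sum into a Parseval partial sum of \<open>u\<close>.\<close>
    also have "\<dots> \<le> (\<Sum>k<Suc n. 2 * pi * (norm (c k))\<^sup>2 * \<rho> ^ (2 * k))"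
      unfolding sum.lessThan_Suc_shift[of _ n] by simp
    also have "\<dots> \<le> K"
      by (rule partial)
    finally show "(\<Sum>k<n. ennreal (v k)) \<le> ennreal K"
      by (simp add: ennreal_leI)
  qed auto
  finally show ?thesis
    by (simp add: F_def)
qed

text \<open>Because \<open>|f| \<le> 1\<close>, the product \<open>f * h\<close> has circle
  integrals no larger than those of \<open>h\<close>, so the area estimate applies to both terms of
  \<open>f' h = (f h)' - f h'\<close>. The 4 is \<open>2 + 2\<close>, from
  \<open>(a + b)^2 \<le> 2 a^2 + 2 b^2\<close>.\<close>

lemma carleson_embedding_square:
  assumes f: "f holomorphic_on ball 0 1" "\<And>z. z \<in> ball 0 1 \<Longrightarrow> norm (f z) \<le> 1"
    and h: "h holomorphic_on ball 0 \<rho>" and \<rho>: "0 < \<rho>" "\<rho> \<le> 1"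
    and bd: "\<And>r. 0 \<le> r \<Longrightarrow> r < \<rho> \<Longrightarrow> circle_integral (\<lambda>z. ennreal ((norm (h z))\<^sup>2)) r \<le> ennreal K" and K: "0 \<le> K"
  shows "(\<integral>\<^sup>+z\<in>ball 0 \<rho>. ennreal ((\<rho> - norm z) * ((norm (deriv f z))\<^sup>2 * (norm (h z))\<^sup>2)) \<partial>lborel) \<le> ennreal (4 * K)"
proof -
  define I where "I u = (\<integral>\<^sup>+z\<in>ball 0 \<rho>. ennreal ((\<rho> - norm z) * (norm (deriv u z))\<^sup>2) \<partial>lborel)" for u :: "complex \<Rightarrow> complex"
  define fh where "fh z = f z * h z" for z
  have f\<rho>: "f holomorphic_on ball 0 \<rho>"
    using f(1) \<rho> by (auto intro: holomorphic_on_subset)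
  have fh: "fh holomorphic_on ball 0 \<rho>"
    unfolding fh_def by (intro holomorphic_intros f\<rho> h)
  have meas: "(\<lambda>z. ennreal ((\<rho> - norm z) * (norm (deriv u z))\<^sup>2) * indicator (ball 0 \<rho>) z) \<in> borel_measurable lborel"
    if "u holomorphic_on ball 0 \<rho>" for u
    using that holomorphic_deriv[OF that]
    by (simp, intro measurable_ennreal_indicator_ball continuous_intros holomorphic_on_imp_continuous_on) auto
  have "I h \<le> ennreal K"
    unfolding I_def by (rule littlewood_paley_area[OF h \<rho> bd K])
  moreover have "I fh \<le> ennreal K"
    unfolding I_def
  proof (rule littlewood_paley_area[OF fh \<rho> _ K])
    fix r assume r: "0 \<le> r" "r < \<rho>"
    have "circle_integral (\<lambda>z. ennreal ((norm (fh z))\<^sup>2)) r \<le> circle_integral (\<lambda>z. ennreal ((norm (h z))\<^sup>2)) r"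
      unfolding circle_integral_def using r \<rho> f(2)
      by (intro nn_integral_mono mult_right_mono ennreal_leI power_mono)
         (auto simp: fh_def norm_mult intro!: mult_left_le_one_le)
    also have "\<dots> \<le> ennreal K"
      by (rule bd[OF r])
    finally show "circle_integral (\<lambda>z. ennreal ((norm (fh z))\<^sup>2)) r \<le> ennreal K" .
  qed
  moreover have "(\<integral>\<^sup>+z\<in>ball 0 \<rho>. ennreal ((\<rho> - norm z) * ((norm (deriv f z))\<^sup>2 * (norm (h z))\<^sup>2)) \<partial>lborel)
      \<le> 2 * I fh + 2 * I h"
  proof -
    have pw: "(norm (deriv f z))\<^sup>2 * (norm (h z))\<^sup>2 \<le> 2 * (norm (deriv fh z))\<^sup>2 + 2 * (norm (deriv h z))\<^sup>2"
      if z: "z \<in> ball 0 \<rho>" for z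
    proof -
      have d: "f field_differentiable at z" "h field_differentiable at z"
        using z f\<rho> h by (auto simp: holomorphic_on_open field_differentiable_def)
      have "deriv fh z = f z * deriv h z + deriv f z * h z"
        unfolding fh_def using d by (intro deriv_mult)
      then have "norm (deriv f z * h z) = norm (deriv fh z - f z * deriv h z)"
        by simp
      also have "\<dots> \<le> norm (deriv fh z) + norm (f z) * norm (deriv h z)"
        by (metis norm_mult norm_triangle_ineq4)
      also have "\<dots> \<le> norm (deriv fh z) + norm (deriv h z)"
        using f(2)[of z] z \<rho> by (auto intro!: mult_left_le_one_le)
      finally have "(norm (deriv f z * h z))\<^sup>2 \<le> (norm (deriv fh z) + norm (deriv h z))\<^sup>2"
        by (rule power_mono) simp
      also have "\<dots> \<le> 2 * (norm (deriv fh z))\<^sup>2 + 2 * (norm (deriv h z))\<^sup>2"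
        using zero_le_power2[of "norm (deriv fh z) - norm (deriv h z)"]
        by (simp add: power2_eq_square algebra_simps)
      finally show ?thesis
        by (simp add: norm_mult power_mult_distrib)
    qed
    have "(\<integral>\<^sup>+z\<in>ball 0 \<rho>. ennreal ((\<rho> - norm z) * ((norm (deriv f z))\<^sup>2 * (norm (h z))\<^sup>2)) \<partial>lborel)
       \<le> (\<integral>\<^sup>+z. 2 * (ennreal ((\<rho> - norm z) * (norm (deriv fh z))\<^sup>2) * indicator (ball 0 \<rho>) z)
              + 2 * (ennreal ((\<rho> - norm z) * (norm (deriv h z))\<^sup>2) * indicator (ball 0 \<rho>) z) \<partial>lborel)"
    proof (rule nn_integral_mono)
      fix z :: complex
      show "ennreal ((\<rho> - norm z) * ((norm (deriv f z))\<^sup>2 * (norm (h z))\<^sup>2)) * indicator (ball 0 \<rho>) z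
        \<le> 2 * (ennreal ((\<rho> - norm z) * (norm (deriv fh z))\<^sup>2) * indicator (ball 0 \<rho>) z)
              + 2 * (ennreal ((\<rho> - norm z) * (norm (deriv h z))\<^sup>2) * indicator (ball 0 \<rho>) z)"
      proof (cases "z \<in> ball 0 \<rho>")
        case True
        then have "(\<rho> - norm z) * ((norm (deriv f z))\<^sup>2 * (norm (h z))\<^sup>2)
            \<le> (\<rho> - norm z) * (2 * (norm (deriv fh z))\<^sup>2 + 2 * (norm (deriv h z))\<^sup>2)"
          by (intro mult_left_mono pw) auto
        also have "\<dots> = 2 * ((\<rho> - norm z) * (norm (deriv fh z))\<^sup>2) + 2 * ((\<rho> - norm z) * (norm (deriv h z))\<^sup>2)"
          by (simp add: algebra_simps)
        finally have "ennreal ((\<rho> - norm z) * ((norm (deriv f z))\<^sup>2 * (norm (h z))\<^sup>2))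
            \<le> ennreal (2 * ((\<rho> - norm z) * (norm (deriv fh z))\<^sup>2) + 2 * ((\<rho> - norm z) * (norm (deriv h z))\<^sup>2))"
          by (rule ennreal_leI)
        also have "\<dots> = 2 * ennreal ((\<rho> - norm z) * (norm (deriv fh z))\<^sup>2) + 2 * ennreal ((\<rho> - norm z) * (norm (deriv h z))\<^sup>2)"
          using True by (subst ennreal_plus) (auto simp: ennreal_mult)
        finally show ?thesis
          using True by simp
      qed simp
    qed
    also have "\<dots> = 2 * I fh + 2 * I h"
      unfolding I_def using meas[OF fh] meas[OF h]
      by (simp add: nn_integral_add nn_integral_cmult)
    finally show ?thesis .
  qed
  ultimately have "(\<integral>\<^sup>+z\<in>ball 0 \<rho>. ennreal ((\<rho> - norm z) * ((norm (deriv f z))\<^sup>2 * (norm (h z))\<^sup>2)) \<partial>lborel)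
      \<le> 2 * ennreal K + 2 * ennreal K"
    by (meson add_mono mult_left_mono order.trans zero_le)
  also have "\<dots> = ennreal (4 * K)"
    using K by (simp add: ennreal_mult flip: distrib_right)
  finally show ?thesis .
qed

section \<open>Removing zeros without changing the modulus on a circle\<close>

text \<open>The whole order of vanishing is divided out at once, so that \<open>a\<close> is no
  longer a zero and an induction on the number of distinct zeros can proceed. Away from
  \<open>a\<close> the quotient is explicit; near \<open>a\<close> it is the nonvanishing local
  factor \<open>P\<close>.\<close>

lemma holomorphic_divide_zero:
  assumes "g holomorphic_on S" "open S" "connected S" "a \<in> S" "\<exists>w\<in>S. g w \<noteq> 0"
  obtains h n where "h holomorphic_on S" "h a \<noteq> 0" "\<And>z. z \<in> S \<Longrightarrow> g z = h z * (z - a) ^ n"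
proof -
  define n where "n = nat (zorder g a)"
  define P where "P = zor_poly g a"
  obtain r where r: "0 < r" "cball a r \<subseteq> S" "P holomorphic_on cball a r"
      "\<And>w. w \<in> cball a r \<Longrightarrow> g w = P w * (w - a) ^ n \<and> P w \<noteq> 0"
    using zorder_exist_zero[OF assms] unfolding n_def P_def by blast
  define h where "h z = (if z = a then P a else g z / (z - a) ^ n)" for z
  have h_P: "h w = P w" if "w \<in> ball a r" for w
    using r(4)[of w] that by (auto simp: h_def)
  have "h holomorphic_on (S - {a}) \<union> ball a r"
  proof (rule holomorphic_on_Un)
    have "(\<lambda>z. g z / (z - a) ^ n) holomorphic_on S - {a}"
      using assms(1) by (intro holomorphic_intros) (auto intro: holomorphic_on_subset)
    then show "h holomorphic_on S - {a}"
      by (rule holomorphic_transform) (simp add: h_def)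
    have "P holomorphic_on ball a r"
      using r(3) by (rule holomorphic_on_subset) auto
    then show "h holomorphic_on ball a r"
      by (rule holomorphic_transform) (simp add: h_P)
  qed (use assms(2) in auto)
  also have "(S - {a}) \<union> ball a r = S"
    using r assms(4) by (auto simp: subset_iff)
  finally have "h holomorphic_on S" .
  moreover have "h a \<noteq> 0"
    using r(1) r(4)[of a] by (simp add: h_def)
  moreover have "g z = h z * (z - a) ^ n" for z
    using r(1) r(4)[of a] by (auto simp: h_def)
  ultimately show thesis
    using that by blast
qed

text \<open>The quotient of the two sides is a Blaschke factor of the disc of radius \<open>\<rho>\<close>.\<close>

lemma norm_blaschke_swap:
  fixes a z :: complex
  assumes \<rho>: "0 < \<rho>" and a: "norm a < \<rho>"
  shows "norm z \<le> \<rho> \<Longrightarrow> norm (z - a) \<le> norm ((of_real (\<rho>\<^sup>2) - cnj a * z) / of_real \<rho>)"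
    and "norm z = \<rho> \<Longrightarrow> norm (z - a) = norm ((of_real (\<rho>\<^sup>2) - cnj a * z) / of_real \<rho>)"
    and "norm z \<le> \<rho> \<Longrightarrow> (of_real (\<rho>\<^sup>2) - cnj a * z) / of_real \<rho> \<noteq> 0"
proof -
  \<comment> \<open>Since \<open>norm a < \<rho>\<close>, the right side has the sign of
    \<open>\<rho>^2 - (norm z)^2\<close>; this gives the inequality inside the disc and equality on
    the circle.\<close>
  have id: "(norm (of_real (\<rho>\<^sup>2) - cnj a * z))\<^sup>2 - (\<rho> * norm (z - a))\<^sup>2 = (\<rho>\<^sup>2 - (norm z)\<^sup>2) * (\<rho>\<^sup>2 - (norm a)\<^sup>2)"
    unfolding power_mult_distrib cmod_power2 by (simp add: power2_eq_square algebra_simps)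
  have le: "\<rho> * norm (z - a) \<le> norm (of_real (\<rho>\<^sup>2) - cnj a * z)" if "norm z \<le> \<rho>"
  proof (rule power2_le_imp_le)
    have "0 \<le> (\<rho>\<^sup>2 - (norm z)\<^sup>2) * (\<rho>\<^sup>2 - (norm a)\<^sup>2)"
      using that a by (intro mult_nonneg_nonneg) (auto intro!: power_mono)
    then show "(\<rho> * norm (z - a))\<^sup>2 \<le> (norm (of_real (\<rho>\<^sup>2) - cnj a * z))\<^sup>2"
      using id by linarith
  qed simp
  show "norm z \<le> \<rho> \<Longrightarrow> norm (z - a) \<le> norm ((of_real (\<rho>\<^sup>2) - cnj a * z) / of_real \<rho>)"
    using le \<rho> by (simp add: norm_divide field_simps)
  show "norm (z - a) = norm ((of_real (\<rho>\<^sup>2) - cnj a * z) / of_real \<rho>)" if "norm z = \<rho>"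
  proof -
    have "(norm (of_real (\<rho>\<^sup>2) - cnj a * z))\<^sup>2 = (\<rho> * norm (z - a))\<^sup>2"
      using id that by simp
    then have "norm (of_real (\<rho>\<^sup>2) - cnj a * z) = \<rho> * norm (z - a)"
      using \<rho> by (simp add: power2_eq_iff_nonneg)
    then show ?thesis
      using \<rho> by (simp add: norm_divide)
  qed
  show "(of_real (\<rho>\<^sup>2) - cnj a * z) / of_real \<rho> \<noteq> 0" if "norm z \<le> \<rho>"
  proof
    assume "(of_real (\<rho>\<^sup>2) - cnj a * z) / of_real \<rho> = 0"
    then have "of_real (\<rho>\<^sup>2) = cnj a * z"
      using \<rho> by simp
    then have "norm (of_real (\<rho>\<^sup>2) :: complex) = norm (cnj a * z)"
      by simp
    then have "\<rho>\<^sup>2 = norm a * norm z"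
      by (simp add: norm_mult norm_power)
    moreover have "norm a * norm z \<le> norm a * \<rho>"
      using that by (intro mult_left_mono) auto
    moreover have "norm a * \<rho> < \<rho> * \<rho>"
      using a \<rho> by simp
    ultimately show False
      by (simp add: power2_eq_square)
  qed
qed

text \<open>Replacing each \<open>(z - a)^n\<close> by the power of its swapped factor keeps the
  modulus on the circle, does not decrease it inside, and removes the zero. Compactness of the
  closed disc in the larger ball makes the zeros finite in number, so the process ends. Zeros on the
  circle itself remain, hence zero-freeness is claimed for the open disc only.\<close>

lemma zero_free_majorant:
  assumes "g holomorphic_on ball 0 R" "\<exists>w\<in>ball 0 R. g w \<noteq> 0" "0 < \<rho>" "\<rho> < R"
  shows "\<exists>F. F holomorphic_on ball 0 R \<and> (\<forall>z\<in>ball 0 \<rho>. F z \<noteq> 0) \<and>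
    (\<forall>z\<in>ball 0 \<rho>. norm (g z) \<le> norm (F z)) \<and> (\<forall>z\<in>sphere 0 \<rho>. norm (F z) = norm (g z))"
  using assms(1,2)
proof (induction "card {z \<in> ball 0 \<rho>. g z = 0}" arbitrary: g rule: less_induct)
  case less
  have "\<not> g constant_on ball 0 R" if "g a = 0" "a \<in> ball 0 R" for a
    using that less.prems(2) unfolding constant_on_def by metis
  moreover have "compact (cball (0::complex) \<rho>)" "cball 0 \<rho> \<subseteq> ball (0::complex) R"
    using assms by auto
  ultimately have fin': "finite {z \<in> cball 0 \<rho>. g z = 0}" if "g a = 0" "a \<in> ball 0 R" for a
    using that less.prems(1) by (intro holomorphic_compact_finite_zeros) auto
  show ?case
  proof (cases "\<exists>a\<in>ball 0 \<rho>. g a = 0")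
    case False
    with less.prems show ?thesis
      by (intro exI[of _ g]) auto
  next
    case True
    then obtain a where a: "norm a < \<rho>" "g a = 0"
      by auto
    then have aR: "a \<in> ball 0 R"
      using assms by auto
    have fin: "finite {z \<in> ball 0 \<rho>. g z = 0}"
      by (rule finite_subset[OF _ fin'[OF a(2) aR]]) auto
    obtain h n where h: "h holomorphic_on ball 0 R" "h a \<noteq> 0" "\<And>z. z \<in> ball 0 R \<Longrightarrow> g z = h z * (z - a) ^ n"
      using holomorphic_divide_zero[OF less.prems(1) open_ball _ aR less.prems(2)] by auto
    define q where "q z = (of_real (\<rho>\<^sup>2) - cnj a * z) / of_real \<rho>" for z
    define g' where "g' z = h z * q z ^ n" for z
    have q0: "q z \<noteq> 0" if "norm z \<le> \<rho>" for z
      unfolding q_def by (rule norm_blaschke_swap(3)[OF assms(3) a(1) that])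
    have g'_hol: "g' holomorphic_on ball 0 R"
      unfolding g'_def q_def using assms(3) by (intro holomorphic_intros h) auto
    have "g' a \<noteq> 0"
      using q0[of a] a h(2) by (simp add: g'_def)
    \<comment> \<open>The swapped factor brings no zero into the disc, and \<open>a\<close> is lost,
      so the count drops strictly.\<close>
    have "{z \<in> ball 0 \<rho>. g' z = 0} \<subset> {z \<in> ball 0 \<rho>. g z = 0}"
    proof (rule psubsetI)
      show "{z \<in> ball 0 \<rho>. g' z = 0} \<subseteq> {z \<in> ball 0 \<rho>. g z = 0}"
        using q0 h(3) assms(4) by (auto simp: g'_def)
      show "{z \<in> ball 0 \<rho>. g' z = 0} \<noteq> {z \<in> ball 0 \<rho>. g z = 0}"
        using \<open>g' a \<noteq> 0\<close> a by auto
    qed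
    then have "card {z \<in> ball 0 \<rho>. g' z = 0} < card {z \<in> ball 0 \<rho>. g z = 0}"
      by (rule psubset_card_mono[OF fin])
    from less.hyps[OF this g'_hol] obtain F where F: "F holomorphic_on ball 0 R" "\<forall>z\<in>ball 0 \<rho>. F z \<noteq> 0"
      "\<forall>z\<in>ball 0 \<rho>. norm (g' z) \<le> norm (F z)" "\<forall>z\<in>sphere 0 \<rho>. norm (F z) = norm (g' z)"
      using \<open>g' a \<noteq> 0\<close> aR by blast
    have "norm (g z) \<le> norm (F z)" if "z \<in> ball 0 \<rho>" for z
      using that assms(4) h(3)[of z] norm_blaschke_swap(1)[OF assms(3) a(1), of z]
      by (auto simp: g'_def q_def norm_mult norm_power
          intro!: order.trans[OF _ F(3)[rule_format, OF that]] mult_left_mono power_mono)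
    moreover have "norm (g' z) = norm (g z)" if "z \<in> sphere 0 \<rho>" for z
      using that assms(4) h(3)[of z] norm_blaschke_swap(2)[OF assms(3) a(1), of z]
      by (simp add: g'_def q_def norm_mult norm_power)
    ultimately show ?thesis
      using F by (intro exI[of _ F]) auto
  qed
qed

section \<open>The embedding for arbitrary positive exponents\<close>

lemma continuous_on_norm_powr:
  fixes f :: "'a::topological_space \<Rightarrow> 'b::real_normed_vector"
  assumes "continuous_on S f" "0 < p"
  shows "continuous_on S (\<lambda>x. norm (f x) powr p)"
  using assms by (intro continuous_on_powr' continuous_intros) auto

text \<open>By Parseval the integral is a power series in the radius with nonnegative
  coefficients.\<close>

lemma circle_integral_norm_sq_mono:
  assumes h: "h holomorphic_on ball 0 R" and r: "0 \<le> r" "r \<le> s" "s < R"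
  shows "circle_integral (\<lambda>z. ennreal ((norm (h z))\<^sup>2)) r \<le> circle_integral (\<lambda>z. ennreal ((norm (h z))\<^sup>2)) s"
proof -
  define c where "c k = (deriv ^^ k) h 0 / fact k" for k
  have sums: "(\<lambda>k. c k * z ^ k) sums h z" if "z \<in> ball 0 R" for z
    using holomorphic_power_series[OF h that] by (simp add: c_def)
  have P: "circle_integral (\<lambda>z. ennreal ((norm (h z))\<^sup>2)) t = (\<Sum>k. ennreal (2 * pi * (norm (c k))\<^sup>2 * t ^ (2 * k)))"
    if "0 \<le> t" "t < R" for t
    by (rule parseval_circle[OF _ that]) (rule sums)
  have "(\<Sum>k. ennreal (2 * pi * (norm (c k))\<^sup>2 * r ^ (2 * k))) \<le> (\<Sum>k. ennreal (2 * pi * (norm (c k))\<^sup>2 * s ^ (2 * k)))"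
    using r by (intro suminf_le ennreal_leI mult_left_mono power_mono) auto
  moreover have "0 \<le> s" "r < R"
    using r by auto
  ultimately show ?thesis
    using r by (simp only: P)
qed

text \<open>Needed because the power of \<open>F\<close> used below exists only on the open disc,
  whereas the modulus comparison with \<open>g\<close> takes place on its boundary circle.
  Continuity on the compact disc supplies a constant dominating function.\<close>

lemma circle_integral_tendsto:
  fixes F :: "complex \<Rightarrow> complex"
  assumes cont: "continuous_on (cball 0 \<rho>) F" and p: "0 < p" and s: "\<And>n. 0 \<le> s n" "\<And>n. s n \<le> \<rho>" "s \<longlonglongrightarrow> \<rho>"
  shows "(\<lambda>n. circle_integral (\<lambda>z. ennreal (norm (F z) powr p)) (s n)) \<longlonglongrightarrow> circle_integral (\<lambda>z. ennreal (norm (F z) powr p)) \<rho>"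
proof -
  have \<rho>: "0 \<le> \<rho>"
    using s(1,2) order.trans by blast
  have cont': "continuous_on (cball 0 \<rho>) (\<lambda>z. norm (F z) powr p)"
    by (rule continuous_on_norm_powr[OF cont p])
  have "bounded ((\<lambda>z. norm (F z) powr p) ` cball 0 \<rho>)"
    by (intro compact_imp_bounded compact_continuous_image cont') auto
  then obtain M where M: "\<And>z. z \<in> cball 0 \<rho> \<Longrightarrow> norm (F z) powr p \<le> M"
    unfolding bounded_iff by fastforce
  have meas: "(\<lambda>t. ennreal (norm (F (of_real r * cis t)) powr p) * indicator {0..2*pi} t) \<in> borel_measurable lborel"
    if "0 \<le> r" "r \<le> \<rho>" for r
  proof -
    have [measurable]: "(\<lambda>t. norm (F (of_real r * cis t)) powr p) \<in> borel_measurable borel"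
      using that
      by (intro borel_measurable_continuous_onI continuous_on_compose2[OF cont'] continuous_intros) (auto simp: norm_mult)
    show ?thesis
      by measurable
  qed
  show ?thesis
    unfolding circle_integral_def
  proof (rule nn_integral_dominated_convergence[where w = "\<lambda>t. ennreal M * indicator {0..2*pi} t"])
    show "AE t in lborel. ennreal (norm (F (of_real (s n) * cis t)) powr p) * indicator {0..2*pi} t \<le> ennreal M * indicator {0..2*pi} t" for n
      using s by (intro AE_I2 mult_right_mono ennreal_leI M) (auto simp: norm_mult)
    show "AE t in lborel. (\<lambda>n. ennreal (norm (F (of_real (s n) * cis t)) powr p) * indicator {0..2*pi} t)
        \<longlonglongrightarrow> ennreal (norm (F (of_real \<rho> * cis t)) powr p) * indicator {0..2*pi} t"
    proof (rule AE_I2)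
      fix t
      have "(\<lambda>n. norm (F (of_real (s n) * cis t)) powr p) \<longlonglongrightarrow> norm (F (of_real \<rho> * cis t)) powr p"
        using s \<rho> by (intro continuous_on_tendsto_compose[OF cont'] tendsto_intros) (auto simp: norm_mult)
      then have "(\<lambda>n. ennreal (norm (F (of_real (s n) * cis t)) powr p)) \<longlonglongrightarrow> ennreal (norm (F (of_real \<rho> * cis t)) powr p)"
        by (rule tendsto_ennrealI)
      then show "(\<lambda>n. ennreal (norm (F (of_real (s n) * cis t)) powr p) * indicator {0..2*pi} t)
          \<longlonglongrightarrow> ennreal (norm (F (of_real \<rho> * cis t)) powr p) * indicator {0..2*pi} t"
        by (cases "t \<in> {0..2*pi}") auto
    qed
    show "(\<integral>\<^sup>+t. ennreal M * indicator {0..2*pi} t \<partial>lborel) < \<infinity>"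
      by (simp add: nn_integral_cmult_indicator ennreal_mult_less_top)
  qed (use meas s \<rho> in auto)
qed

text \<open>Replacing \<open>g\<close> by a zero-free majorant \<open>F\<close> with the same modulus on the circle reduces to
  exponent \<open>2\<close>, applied to the holomorphic function \<open>F\<^bsup>p/2\<^esup>\<close>.\<close>

lemma carleson_embedding:
  assumes f: "f holomorphic_on ball 0 1" "\<And>z. z \<in> ball 0 1 \<Longrightarrow> norm (f z) \<le> 1"
    and g: "g holomorphic_on ball 0 1" and p: "0 < p" and \<rho>: "0 < \<rho>" "\<rho> < 1"
    and bd: "circle_integral (\<lambda>z. ennreal (norm (g z) powr p)) \<rho> \<le> ennreal K" and K: "0 \<le> K"
  shows "(\<integral>\<^sup>+z\<in>ball 0 \<rho>. ennreal ((\<rho> - norm z) * ((norm (deriv f z))\<^sup>2 * norm (g z) powr p)) \<partial>lborel) \<le> ennreal (4 * K)"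
proof (cases "\<exists>w\<in>ball 0 1. g w \<noteq> 0")
  case False
  then have "(\<integral>\<^sup>+z\<in>ball 0 \<rho>. ennreal ((\<rho> - norm z) * ((norm (deriv f z))\<^sup>2 * norm (g z) powr p)) \<partial>lborel) = (\<integral>\<^sup>+(z::complex). 0 \<partial>lborel)"
    using \<rho> by (intro nn_integral_cong) (auto split: split_indicator)
  then show ?thesis by simp
next
  case True
  obtain F where F: "F holomorphic_on ball 0 1" "\<forall>z\<in>ball 0 \<rho>. F z \<noteq> 0"
      "\<forall>z\<in>ball 0 \<rho>. norm (g z) \<le> norm (F z)" "\<forall>z\<in>sphere 0 \<rho>. norm (F z) = norm (g z)"
    using zero_free_majorant[OF g True \<rho>] by blast
  have F\<rho>: "F holomorphic_on ball 0 \<rho>"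
    using F(1) \<rho> by (auto intro: holomorphic_on_subset)
  obtain L where L: "L holomorphic_on ball 0 \<rho>" "\<And>z. z \<in> ball 0 \<rho> \<Longrightarrow> F z = exp (L z)"
    using contractible_imp_holomorphic_log[OF F\<rho>] F(2) convex_imp_contractible[OF convex_ball] by metis
  \<comment> \<open>A holomorphic branch of \<open>F\<close> to the power \<open>p/2\<close>,
    available since \<open>F\<close> has no zeros on a contractible set.\<close>
  define h where "h z = exp (of_real (p / 2) * L z)" for z
  have h: "h holomorphic_on ball 0 \<rho>"
    unfolding h_def by (intro holomorphic_intros L)
  have h_sq: "(norm (h z))\<^sup>2 = norm (F z) powr p" if "z \<in> ball 0 \<rho>" for z
    using L(2)[OF that] by (simp add: h_def norm_exp_eq_Re powr_def power2_eq_square flip: exp_add)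
  have "circle_integral (\<lambda>z. ennreal ((norm (h z))\<^sup>2)) r \<le> ennreal K" if r: "0 \<le> r" "r < \<rho>" for r
  proof -
    \<comment> \<open>Radii from \<open>r\<close> (at \<open>n = 0\<close>) up to
      \<open>\<rho>\<close>: monotonicity for \<open>h\<close> gives a bound at each
      \<open>s n\<close>, and the limit lands on the circle where \<open>F\<close> and
      \<open>g\<close> have equal modulus.\<close>
    define s where "s n = \<rho> - (\<rho> - r) / real (Suc n)" for n
    have s: "r \<le> s n" "s n < \<rho>" for n
    proof -
      have "(\<rho> - r) / real (Suc n) \<le> (\<rho> - r) / 1"
        using r by (intro divide_left_mono) auto
      then show "r \<le> s n" "s n < \<rho>"
        using r by (auto simp: s_def)
    qed
    have "s \<longlonglongrightarrow> \<rho> - 0"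
      unfolding s_def by (intro tendsto_diff tendsto_const LIMSEQ_Suc[OF lim_const_over_n])
    then have s_lim: "s \<longlonglongrightarrow> \<rho>"
      by simp
    have "(\<lambda>n. circle_integral (\<lambda>z. ennreal (norm (F z) powr p)) (s n)) \<longlonglongrightarrow> circle_integral (\<lambda>z. ennreal (norm (F z) powr p)) \<rho>"
    proof (rule circle_integral_tendsto[OF _ p _ _ s_lim])
      show "continuous_on (cball 0 \<rho>) F"
        using F(1) \<rho> by (intro holomorphic_on_imp_continuous_on) (auto intro: holomorphic_on_subset)
      show "0 \<le> s n" "s n \<le> \<rho>" for n
        using s[of n] r by auto
    qed
    moreover have "circle_integral (\<lambda>z. ennreal ((norm (h z))\<^sup>2)) r \<le> circle_integral (\<lambda>z. ennreal (norm (F z) powr p)) (s n)" for n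
    proof -
      have "circle_integral (\<lambda>z. ennreal ((norm (h z))\<^sup>2)) r \<le> circle_integral (\<lambda>z. ennreal ((norm (h z))\<^sup>2)) (s n)"
        by (rule circle_integral_norm_sq_mono[OF h r(1) s])
      also have "\<dots> = circle_integral (\<lambda>z. ennreal (norm (F z) powr p)) (s n)"
        using s[of n] r unfolding circle_integral_def by (intro nn_integral_cong) (simp add: h_sq norm_mult)
      finally show ?thesis .
    qed
    ultimately have "circle_integral (\<lambda>z. ennreal ((norm (h z))\<^sup>2)) r \<le> circle_integral (\<lambda>z. ennreal (norm (F z) powr p)) \<rho>"
      by (intro LIMSEQ_le_const) auto
    also have "\<dots> = circle_integral (\<lambda>z. ennreal (norm (g z) powr p)) \<rho>"
      using F(4) \<rho> unfolding circle_integral_def by (intro nn_integral_cong) (simp add: norm_mult)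
    finally show ?thesis
      using bd by (rule order.trans)
  qed
  then have "(\<integral>\<^sup>+z\<in>ball 0 \<rho>. ennreal ((\<rho> - norm z) * ((norm (deriv f z))\<^sup>2 * (norm (h z))\<^sup>2)) \<partial>lborel) \<le> ennreal (4 * K)"
    using f h \<rho> K by (intro carleson_embedding_square) auto
  moreover have "(\<integral>\<^sup>+z\<in>ball 0 \<rho>. ennreal ((\<rho> - norm z) * ((norm (deriv f z))\<^sup>2 * norm (g z) powr p)) \<partial>lborel)
      \<le> (\<integral>\<^sup>+z\<in>ball 0 \<rho>. ennreal ((\<rho> - norm z) * ((norm (deriv f z))\<^sup>2 * (norm (h z))\<^sup>2)) \<partial>lborel)"
  proof (rule nn_integral_mono)
    fix z :: complex
    show "ennreal ((\<rho> - norm z) * ((norm (deriv f z))\<^sup>2 * norm (g z) powr p)) * indicator (ball 0 \<rho>) z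
      \<le> ennreal ((\<rho> - norm z) * ((norm (deriv f z))\<^sup>2 * (norm (h z))\<^sup>2)) * indicator (ball 0 \<rho>) z"
    proof (cases "z \<in> ball 0 \<rho>")
      case True
      then have "(\<rho> - norm z) * ((norm (deriv f z))\<^sup>2 * norm (g z) powr p)
          \<le> (\<rho> - norm z) * ((norm (deriv f z))\<^sup>2 * norm (F z) powr p)"
        using F(3) p by (intro mult_left_mono powr_mono2) auto
      then show ?thesis
        using True by (simp add: h_sq ennreal_leI)
    qed simp
  qed
  ultimately show ?thesis
    by (rule order.trans[rotated])
qed

section \<open>Finite Blaschke products\<close>

lemma blaschke_factor_bounds:
  fixes a z :: complex
  assumes a: "norm a < 1" and z: "norm z < 1"
  shows "1 - cnj a * z \<noteq> 0" and "norm ((z - a) / (1 - cnj a * z)) \<le> 1"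
    and "((\<lambda>z. (z - a) / (1 - cnj a * z)) has_field_derivative of_real (1 - (norm a)\<^sup>2) / (1 - cnj a * z)\<^sup>2) (at z)"
proof -
  show nz: "1 - cnj a * z \<noteq> 0"
    using norm_blaschke_swap(3)[of 1 a z] a z by simp
  show "norm ((z - a) / (1 - cnj a * z)) \<le> 1"
    using norm_blaschke_swap(1)[of 1 a z] a z nz by (simp add: norm_divide)
  have "((\<lambda>z. (z - a) / (1 - cnj a * z)) has_field_derivative
      (1 * (1 - cnj a * z) - (z - a) * (0 - cnj a * 1)) / ((1 - cnj a * z) * (1 - cnj a * z))) (at z)"
    by (intro derivative_intros DERIV_divide nz) (auto intro!: derivative_eq_intros)
  also have "1 * (1 - cnj a * z) - (z - a) * (0 - cnj a * 1) = of_real (1 - (norm a)\<^sup>2)"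
    using complex_norm_square[of a] by (simp add: algebra_simps)
  finally show "((\<lambda>z. (z - a) / (1 - cnj a * z)) has_field_derivative of_real (1 - (norm a)\<^sup>2) / (1 - cnj a * z)\<^sup>2) (at z)"
    by (simp add: power2_eq_square)
qed

text \<open>In the product rule every undifferentiated factor has modulus at most 1, so only the
  derivatives of the single factors remain. Their moduli coincide with Poisson kernels when
  \<open>norm z = 1\<close>.\<close>

lemma blaschke_prod_bounds:
  fixes a :: "nat \<Rightarrow> complex"
  assumes a: "\<And>k. k < n \<Longrightarrow> norm (a k) < 1" and z: "norm z < 1"
  defines "P \<equiv> \<lambda>n z. \<Prod>k<n. (z - a k) / (1 - cnj (a k) * z)"
  shows "norm (P n z) \<le> 1 \<and> (\<exists>D. (P n has_field_derivative D) (at z) \<and>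
    norm D \<le> (\<Sum>k<n. (1 - (norm (a k))\<^sup>2) / (norm (1 - cnj (a k) * z))\<^sup>2))"
  using a
proof (induction n)
  case 0
  show ?case
    by (auto simp: P_def)
next
  case (Suc n)
  define b where "b z = (z - a n) / (1 - cnj (a n) * z)" for z
  define b' where "b' = of_real (1 - (norm (a n))\<^sup>2) / (1 - cnj (a n) * z)\<^sup>2"
  have an: "norm (a n) < 1"
    using Suc.prems by simp
  have b: "norm (b z) \<le> 1" "(b has_field_derivative b') (at z)"
    unfolding b_def b'_def using blaschke_factor_bounds[OF an z] by auto
  have PS: "P (Suc n) = (\<lambda>z. P n z * b z)"
    by (simp add: P_def b_def fun_eq_iff)
  obtain D where D: "norm (P n z) \<le> 1" "(P n has_field_derivative D) (at z)"
      "norm D \<le> (\<Sum>k<n. (1 - (norm (a k))\<^sup>2) / (norm (1 - cnj (a k) * z))\<^sup>2)"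
    using Suc by auto
  have "norm (P (Suc n) z) \<le> 1"
    using D(1) b(1) by (simp add: PS norm_mult mult_le_one)
  moreover have "(P (Suc n) has_field_derivative D * b z + b' * P n z) (at z)"
    unfolding PS by (rule DERIV_mult[OF D(2) b(2)])
  moreover have "norm (D * b z + b' * P n z) \<le> (\<Sum>k<Suc n. (1 - (norm (a k))\<^sup>2) / (norm (1 - cnj (a k) * z))\<^sup>2)"
  proof -
    have "norm (D * b z + b' * P n z) \<le> norm D * norm (b z) + norm b' * norm (P n z)"
      by (metis norm_mult norm_triangle_ineq)
    also have "\<dots> \<le> norm D * 1 + norm b' * 1"
      by (intro add_mono mult_left_mono D b) auto
    also have "norm b' = (1 - (norm (a n))\<^sup>2) / (norm (1 - cnj (a n) * z))\<^sup>2"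
      using an unfolding b'_def norm_divide norm_power norm_of_real by (simp add: abs_square_le_1)
    finally show ?thesis
      using D(3) by simp
  qed
  ultimately show ?case
    by blast
qed

text \<open>The integrand is the squared modulus of \<open>u\<close>, the normalised Szego kernel at
  \<open>a\<close>, with coefficients \<open>sqrt (1 - |a|^2) * cnj a ^ k\<close>. Parseval leaves a
  geometric series whose sum cancels \<open>1 - |a|^2\<close>.\<close>

lemma circle_integral_poisson_le:
  fixes a :: complex
  assumes a: "norm a < 1" and r: "0 \<le> r" "r < 1"
  shows "circle_integral (\<lambda>z. ennreal ((1 - (norm a)\<^sup>2) / (norm (1 - cnj a * z))\<^sup>2)) r \<le> ennreal (2 * pi)"
proof -
  define x where "x = (norm a)\<^sup>2"
  have x: "0 \<le> x" "x < 1"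
    using a by (auto simp: x_def abs_square_less_1)
  define u where "u z = of_real (sqrt (1 - x)) * (1 / (1 - cnj a * z))" for z
  define c where "c k = of_real (sqrt (1 - x)) * cnj a ^ k" for k
  have "circle_integral (\<lambda>z. ennreal ((norm (u z))\<^sup>2)) r = (\<Sum>k. ennreal (2 * pi * (norm (c k))\<^sup>2 * r ^ (2 * k)))"
  proof (rule parseval_circle[OF _ r])
    fix z :: complex assume "z \<in> ball 0 1"
    then have "norm (cnj a * z) < 1"
      using a mult_strict_mono'[of "norm a" 1 "norm z" 1] by (simp add: norm_mult)
    from sums_mult[OF geometric_sums[OF this], of "of_real (sqrt (1 - x))"]
    show "(\<lambda>k. c k * z ^ k) sums u z"
      by (simp add: c_def u_def power_mult_distrib mult.assoc)
  qed
  also have "\<dots> \<le> ennreal (2 * pi)"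
  proof (rule suminf_le_const)
    fix n
    have "(\<Sum>k<n. ennreal (2 * pi * (norm (c k))\<^sup>2 * r ^ (2 * k))) = ennreal (\<Sum>k<n. 2 * pi * (norm (c k))\<^sup>2 * r ^ (2 * k))"
      using r by (intro sum_ennreal) auto
    also have "(\<Sum>k<n. 2 * pi * (norm (c k))\<^sup>2 * r ^ (2 * k)) \<le> (\<Sum>k<n. 2 * pi * (norm (c k))\<^sup>2 * 1)"
      using r by (intro sum_mono mult_left_mono power_le_one) auto
    also have "\<dots> = 2 * pi * ((1 - x) * (\<Sum>k<n. x ^ k))"
    proof -
      have "(norm a ^ k)\<^sup>2 = ((norm a)\<^sup>2) ^ k" for k
        by (simp add: mult.commute flip: power_mult)
      then have "(norm (c k))\<^sup>2 = (1 - x) * x ^ k" for k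
        using x by (simp add: c_def norm_mult norm_power power_mult_distrib x_def)
      then show ?thesis
        by (simp add: sum_distrib_left mult.assoc)
    qed
    also have "\<dots> = 2 * pi * (1 - x ^ n)"
      by (simp only: one_diff_power_eq)
    also have "\<dots> \<le> 2 * pi"
      using x by simp
    finally show "(\<Sum>k<n. ennreal (2 * pi * (norm (c k))\<^sup>2 * r ^ (2 * k))) \<le> ennreal (2 * pi)"
      by (simp add: ennreal_leI)
  qed auto
  also have "(\<lambda>z. ennreal ((norm (u z))\<^sup>2)) = (\<lambda>z. ennreal ((1 - (norm a)\<^sup>2) / (norm (1 - cnj a * z))\<^sup>2))"
    using x by (simp add: u_def x_def norm_mult norm_divide power_divide power_mult_distrib)
  finally show ?thesis .
qed

text \<open>In the last claim each of the \<open>n\<close> factors contributes at most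
  \<open>2 * pi\<close>, however close its zero is to the boundary.\<close>

lemma finite_blaschke_bounds:
  assumes "finite_blaschke n B"
  shows "B holomorphic_on ball 0 1" and "\<And>z. z \<in> ball 0 1 \<Longrightarrow> norm (B z) \<le> 1"
    and "\<And>r. 0 \<le> r \<Longrightarrow> r < 1 \<Longrightarrow> circle_integral (\<lambda>z. ennreal (norm (deriv B z))) r \<le> ennreal (2 * pi * real n)"
proof -
  obtain c a where c: "norm c = 1" and a: "\<And>k. k < n \<Longrightarrow> norm (a k) < 1"
    and B: "\<And>z. z \<in> ball 0 1 \<Longrightarrow> B z = c * (\<Prod>k<n. (z - a k) / (1 - cnj (a k) * z))"
    using assms unfolding finite_blaschke_def by blast
  have D: "norm (B z) \<le> 1 \<and> (\<exists>D. (B has_field_derivative D) (at z) \<and>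
      norm D \<le> (\<Sum>k<n. (1 - (norm (a k))\<^sup>2) / (norm (1 - cnj (a k) * z))\<^sup>2))" if z: "z \<in> ball 0 1" for z
  proof -
    define P where "P = (\<lambda>z. \<Prod>k<n. (z - a k) / (1 - cnj (a k) * z))"
    obtain D where D: "norm (P z) \<le> 1" "(P has_field_derivative D) (at z)"
      "norm D \<le> (\<Sum>k<n. (1 - (norm (a k))\<^sup>2) / (norm (1 - cnj (a k) * z))\<^sup>2)"
      using blaschke_prod_bounds[of n a z] a z unfolding P_def by auto
    have "((\<lambda>z. c * P z) has_field_derivative c * D) (at z)"
      by (rule DERIV_cmult[OF D(2)])
    \<comment> \<open>\<open>B\<close> is prescribed only on the disc; openness of the disc
      transfers the derivative from the product.\<close>
    then have "(B has_field_derivative c * D) (at z)"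
      by (rule has_field_derivative_transform_within_open[where S = "ball 0 1"]) (use z B in \<open>auto simp: P_def\<close>)
    moreover have "norm (c * D) \<le> (\<Sum>k<n. (1 - (norm (a k))\<^sup>2) / (norm (1 - cnj (a k) * z))\<^sup>2)"
      using D(3) c by (simp add: norm_mult)
    moreover have "norm (B z) \<le> 1"
      using D(1) c B[OF z] by (simp add: norm_mult P_def)
    ultimately show ?thesis
      by blast
  qed
  show "B holomorphic_on ball 0 1"
    unfolding holomorphic_on_open[OF open_ball] using D by blast
  show "\<And>z. z \<in> ball 0 1 \<Longrightarrow> norm (B z) \<le> 1"
    using D by blast
  fix r :: real assume r: "0 \<le> r" "r < 1"
  have "circle_integral (\<lambda>z. ennreal (norm (deriv B z))) r
      \<le> circle_integral (\<lambda>z. \<Sum>k<n. ennreal ((1 - (norm (a k))\<^sup>2) / (norm (1 - cnj (a k) * z))\<^sup>2)) r"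
    unfolding circle_integral_def
  proof (intro nn_integral_mono mult_right_mono)
    fix t
    have "of_real r * cis t \<in> ball 0 1"
      using r by (simp add: norm_mult)
    then obtain D' where "(B has_field_derivative D') (at (of_real r * cis t))"
        "norm D' \<le> (\<Sum>k<n. (1 - (norm (a k))\<^sup>2) / (norm (1 - cnj (a k) * (of_real r * cis t)))\<^sup>2)"
      using D by blast
    then have "norm (deriv B (of_real r * cis t)) \<le> (\<Sum>k<n. (1 - (norm (a k))\<^sup>2) / (norm (1 - cnj (a k) * (of_real r * cis t)))\<^sup>2)"
      by (simp add: DERIV_imp_deriv)
    also have "ennreal \<dots> = (\<Sum>k<n. ennreal ((1 - (norm (a k))\<^sup>2) / (norm (1 - cnj (a k) * (of_real r * cis t)))\<^sup>2))"
      using a by (intro sum_ennreal[symmetric] divide_nonneg_nonneg) (auto simp: abs_square_le_1 less_imp_le)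
    finally show "ennreal (norm (deriv B (of_real r * cis t)))
        \<le> (\<Sum>k<n. ennreal ((1 - (norm (a k))\<^sup>2) / (norm (1 - cnj (a k) * (of_real r * cis t)))\<^sup>2))"
      by (simp add: ennreal_leI)
  qed simp
  also have "\<dots> = (\<Sum>k<n. circle_integral (\<lambda>z. ennreal ((1 - (norm (a k))\<^sup>2) / (norm (1 - cnj (a k) * z))\<^sup>2)) r)"
    unfolding circle_integral_def sum_distrib_right by (rule nn_integral_sum) measurable
  also have "\<dots> \<le> (\<Sum>k<n. ennreal (2 * pi))"
    by (intro sum_mono circle_integral_poisson_le a r) auto
  also have "\<dots> = ennreal (2 * pi * real n)"
    by (simp add: ennreal_of_nat_eq_real_of_nat mult.commute flip: ennreal_mult)
  finally show "circle_integral (\<lambda>z. ennreal (norm (deriv B z))) r \<le> ennreal (2 * pi * real n)" .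
qed

section \<open>The area estimate\<close>

text \<open>Cauchy's estimate on the disc reaching half way to the boundary. The values lie in the
  open ball of radius 2, and 2 divided by the radius \<open>(1 - norm z) / 2\<close> gives the
  4.\<close>

lemma norm_deriv_le_of_bounded:
  assumes f: "f holomorphic_on ball 0 1" "\<And>z. z \<in> ball 0 1 \<Longrightarrow> norm (f z) \<le> 1" and z: "norm z < 1"
  shows "norm (deriv f z) \<le> 4 / (1 - norm z)"
proof -
  define r where "r = (1 - norm z) / 2"
  have sub: "cball z r \<subseteq> ball 0 1"
  proof
    fix w assume "w \<in> cball z r"
    then have "norm (z - w) \<le> r"
      by (simp add: dist_norm)
    moreover have "norm w \<le> norm z + norm (z - w)"
      by (metis norm_minus_commute norm_triangle_sub)
    ultimately show "w \<in> ball 0 1"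
      using z by (simp add: r_def)
  qed
  have "norm ((deriv ^^ 1) f z) \<le> fact 1 * 2 / r ^ 1"
  proof (rule Cauchy_higher_deriv_bound)
    show "f holomorphic_on ball z r"
      using f(1) sub by (rule holomorphic_on_subset[OF _ order.trans[OF ball_subset_cball]])
    show "continuous_on (cball z r) f"
      using f(1) sub by (meson holomorphic_on_imp_continuous_on continuous_on_subset)
    show "f w \<in> ball 0 2" if "w \<in> ball z r" for w
    proof -
      have "norm (f w) \<le> 1"
        using that sub ball_subset_cball by (intro f(2)) blast
      then show ?thesis
        by simp
    qed
  qed (use z in \<open>auto simp: r_def\<close>)
  then show ?thesis
    by (simp add: r_def)
qed

text \<open>Split according to whether \<open>norm g\<close> exceeds the threshold \<open>T\<close>, which balances the two parts.\<close>

lemma circle_integral_deriv_mult_le: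
  assumes f: "f holomorphic_on ball 0 1" "\<And>z. z \<in> ball 0 1 \<Longrightarrow> norm (f z) \<le> 1"
    and g: "g holomorphic_on ball 0 1" and q: "1 < q" and r: "0 \<le> r" "r < 1" and n: "0 < n"
    and bf: "circle_integral (\<lambda>z. ennreal (norm (deriv f z))) r \<le> ennreal (2 * pi * real n)"
    and bg: "circle_integral (\<lambda>z. ennreal (norm (g z) powr q)) r \<le> ennreal K" and K: "0 \<le> K"
  shows "circle_integral (\<lambda>z. ennreal (norm (deriv f z * g z))) r
    \<le> ennreal ((2 * pi + 4 * K) * real n powr (1 - 1 / q) * (1 - r) powr (- 1 / q))"
proof -
  define \<delta> where "\<delta> = 1 - r"
  have \<delta>: "0 < \<delta>"
    using r by (simp add: \<delta>_def)
  \<comment> \<open>Solves \<open>n * T = T powr (1 - q) / \<delta>\<close>, the equality of the two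
    contributions up to constants.\<close>
  define T where "T = (real n * \<delta>) powr (- 1 / q)"
  have T: "0 < T"
    using n \<delta> by (simp add: T_def)
  define A where "A = 4 / \<delta> * T powr (1 - q)"
  have A: "0 \<le> A"
    using \<delta> by (simp add: A_def)
  have pw: "norm (deriv f z * g z) \<le> T * norm (deriv f z) + A * norm (g z) powr q" if z: "norm z = r" for z
  proof (cases "norm (g z) \<le> T")
    case True
    then have "norm (deriv f z * g z) \<le> T * norm (deriv f z)"
      by (simp add: norm_mult mult.commute mult_right_mono)
    then show ?thesis
      using A by (simp add: add_increasing2)
  next
    case False
    then have x: "T \<le> norm (g z)" "0 < norm (g z)"
      using T by linarith+
    \<comment> \<open>Above the threshold the negative exponent \<open>1 - q\<close> trades
      \<open>|g|\<close> for its power \<open>q\<close> at the cost of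
      \<open>T powr (1 - q)\<close>.\<close>
    have "norm (g z) = norm (g z) powr (1 - q) * norm (g z) powr q"
      using x by (simp flip: powr_add)
    also have "\<dots> \<le> T powr (1 - q) * norm (g z) powr q"
      using x T q by (intro mult_right_mono powr_mono2') auto
    finally have "norm (deriv f z) * norm (g z) \<le> 4 / \<delta> * (T powr (1 - q) * norm (g z) powr q)"
      using norm_deriv_le_of_bounded[OF f, of z] z r by (intro mult_mono) (auto simp: \<delta>_def)
    then have "norm (deriv f z * g z) \<le> A * norm (g z) powr q"
      by (simp add: norm_mult A_def mult.assoc)
    then show ?thesis
      using T by (simp add: add_increasing)
  qed
  have f': "deriv f holomorphic_on ball 0 1"
    by (intro holomorphic_deriv f) auto
  have [measurable]: "(\<lambda>t. deriv f (of_real r * cis t)) \<in> borel_measurable borel"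
    using r
    by (intro borel_measurable_continuous_onI continuous_on_compose2[OF holomorphic_on_imp_continuous_on[OF f']] continuous_intros)
       (auto simp: norm_mult)
  have [measurable]: "(\<lambda>t. g (of_real r * cis t)) \<in> borel_measurable borel"
    using r
    by (intro borel_measurable_continuous_onI continuous_on_compose2[OF holomorphic_on_imp_continuous_on[OF g]] continuous_intros)
       (auto simp: norm_mult)
  have "circle_integral (\<lambda>z. ennreal (norm (deriv f z * g z))) r
      \<le> (\<integral>\<^sup>+t. ennreal T * (ennreal (norm (deriv f (of_real r * cis t))) * indicator {0..2*pi} t)
            + ennreal A * (ennreal (norm (g (of_real r * cis t)) powr q) * indicator {0..2*pi} t) \<partial>lborel)"
    unfolding circle_integral_def
  proof (rule nn_integral_mono)
    fix t
    have "ennreal (norm (deriv f (of_real r * cis t) * g (of_real r * cis t)))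
        \<le> ennreal (T * norm (deriv f (of_real r * cis t)) + A * norm (g (of_real r * cis t)) powr q)"
      using r by (intro ennreal_leI pw) (simp add: norm_mult)
    also have "\<dots> = ennreal T * ennreal (norm (deriv f (of_real r * cis t))) + ennreal A * ennreal (norm (g (of_real r * cis t)) powr q)"
      using T A by (simp add: ennreal_mult)
    finally show "ennreal (norm (deriv f (of_real r * cis t) * g (of_real r * cis t))) * indicator {0..2*pi} t
        \<le> ennreal T * (ennreal (norm (deriv f (of_real r * cis t))) * indicator {0..2*pi} t)
            + ennreal A * (ennreal (norm (g (of_real r * cis t)) powr q) * indicator {0..2*pi} t)"
      by (auto split: split_indicator)
  qed
  also have "\<dots> = ennreal T * circle_integral (\<lambda>z. ennreal (norm (deriv f z))) r + ennreal A * circle_integral (\<lambda>z. ennreal (norm (g z) powr q)) r"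
    unfolding circle_integral_def by (simp add: nn_integral_add nn_integral_cmult)
  also have "\<dots> \<le> ennreal T * ennreal (2 * pi * real n) + ennreal A * ennreal K"
    by (intro add_mono mult_left_mono bf bg) auto
  also have "\<dots> = ennreal (T * (2 * pi * real n) + A * K)"
    using T A K by (simp add: ennreal_mult)
  also have "T * (2 * pi * real n) + A * K = (2 * pi + 4 * K) * real n powr (1 - 1 / q) * (1 - r) powr (- 1 / q)"
  proof -
    have "real n * T = real n powr 1 * real n powr (- 1 / q) * \<delta> powr (- 1 / q)"
      using n \<delta> by (simp add: T_def powr_mult)
    also have "\<dots> = real n powr (1 - 1 / q) * \<delta> powr (- 1 / q)"
      unfolding powr_add[symmetric] by simp
    finally have 1: "real n * T = real n powr (1 - 1 / q) * \<delta> powr (- 1 / q)" .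
    have "- 1 / q * (1 - q) = 1 - 1 / q"
      using q by (simp add: field_simps)
    then have "T powr (1 - q) / \<delta> = (real n * \<delta>) powr (1 - 1 / q) * \<delta> powr - 1"
      using \<delta> unfolding T_def powr_powr by (simp add: powr_minus divide_inverse)
    also have "\<dots> = real n powr (1 - 1 / q) * (\<delta> powr (1 - 1 / q) * \<delta> powr - 1)"
      using n \<delta> by (simp add: powr_mult)
    also have "\<delta> powr (1 - 1 / q) * \<delta> powr - 1 = \<delta> powr (- 1 / q)"
      unfolding powr_add[symmetric] by simp
    finally have 2: "T powr (1 - q) / \<delta> = real n powr (1 - 1 / q) * \<delta> powr (- 1 / q)" .
    have "T * (2 * pi * real n) + A * K = 2 * pi * (real n * T) + 4 * K * (T powr (1 - q) / \<delta>)"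
      by (simp add: A_def)
    also have "\<dots> = (2 * pi + 4 * K) * (real n powr (1 - 1 / q) * \<delta> powr (- 1 / q))"
      unfolding 1 2 by (rule distrib_right[symmetric])
    finally show ?thesis
      by (simp add: \<delta>_def mult.assoc)
  qed
  finally show ?thesis .
qed

section \<open>The outer annulus\<close>

lemma measurable_deriv_mult_ball:
  assumes "f holomorphic_on ball 0 1" "g holomorphic_on ball 0 1"
  shows "(\<lambda>z. ennreal (norm (deriv f z * g z)) * indicator (ball 0 1) z) \<in> borel_measurable borel"
  using assms
  by (intro measurable_ennreal_indicator_ball continuous_intros holomorphic_on_imp_continuous_on holomorphic_deriv) auto

lemma outer_annulus_bound:
  assumes f: "f holomorphic_on ball 0 1" "\<And>z. z \<in> ball 0 1 \<Longrightarrow> norm (f z) \<le> 1"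
    and g: "g holomorphic_on ball 0 1" and q: "1 < q" and n: "0 < n"
    and bf: "\<And>r. 0 \<le> r \<Longrightarrow> r < 1 \<Longrightarrow> circle_integral (\<lambda>z. ennreal (norm (deriv f z))) r \<le> ennreal (2 * pi * real n)"
    and bg: "\<And>r. 0 \<le> r \<Longrightarrow> r < 1 \<Longrightarrow> circle_integral (\<lambda>z. ennreal (norm (g z) powr q)) r \<le> ennreal K" and K: "0 \<le> K"
  shows "(\<integral>\<^sup>+z\<in>ball 0 1 - ball 0 (1 - 1 / real n). ennreal (norm (deriv f z * g z)) \<partial>lborel)
    \<le> ennreal ((2 * pi + 4 * K) / (1 - 1 / q))"
proof -
  define s where "s = 1 - 1 / real n"
  have s: "0 \<le> s" "s < 1" "1 - s = 1 / real n"
    using n by (auto simp: s_def)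
  define c where "c = (2 * pi + 4 * K) * real n powr (1 - 1 / q)"
  have c: "0 \<le> c"
    using K by (simp add: c_def)
  define F where "F z = ennreal (norm (deriv f z * g z)) * indicator (ball 0 1 - ball 0 s) z" for z
  define \<Phi> where "\<Phi> r = ennreal (c * (1 - r) powr (- 1 / q)) * indicator {s..1} r" for r
  have "F = (\<lambda>z. ennreal (norm (deriv f z * g z)) * indicator (ball 0 1) z * indicator (- ball 0 s) z)"
    by (auto simp: F_def fun_eq_iff split: split_indicator)
  also have "\<dots> \<in> borel_measurable borel"
    using measurable_deriv_mult_ball[OF f(1) g]
    by (rule borel_measurable_times_ennreal) (intro borel_measurable_indicator, auto)
  finally have "F \<in> borel_measurable borel" .
  then have "(\<integral>\<^sup>+z. F z \<partial>lborel) \<le> (\<integral>\<^sup>+r\<in>{0..}. ennreal r * \<Phi> r \<partial>lborel)"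
  proof (rule nn_integral_polar_le)
    fix r :: real assume r: "0 \<le> r"
    show "circle_integral F r \<le> \<Phi> r"
    proof (cases "s \<le> r \<and> r < 1")
      case True
      then have "circle_integral F r = circle_integral (\<lambda>z. ennreal (norm (deriv f z * g z))) r"
        using r unfolding circle_integral_def F_def by (intro nn_integral_cong) (simp add: norm_mult)
      also have "\<dots> \<le> ennreal (c * (1 - r) powr (- 1 / q))"
        using True r unfolding c_def
        by (intro circle_integral_deriv_mult_le f g q n bf bg K) auto
      finally show ?thesis
        using True by (simp add: \<Phi>_def)
    next
      case False
      then have "circle_integral F r = (\<integral>\<^sup>+(t::real). 0 \<partial>lborel)"
        using r unfolding circle_integral_def F_def by (intro nn_integral_cong) (auto simp: norm_mult)
      then show ?thesis
        by simp
    qed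
  qed
  also have "\<dots> \<le> (\<integral>\<^sup>+r. \<Phi> r \<partial>lborel)"
  proof (rule nn_integral_mono)
    fix r
    have "ennreal r * \<Phi> r \<le> 1 * \<Phi> r" if "r \<le> 1"
      using that by (intro mult_right_mono) auto
    then show "ennreal r * \<Phi> r * indicator {0..} r \<le> \<Phi> r"
      by (cases "r \<le> 1") (auto simp: \<Phi>_def split: split_indicator)
  qed
  also have "\<dots> = (\<integral>\<^sup>+r\<in>{0..1 / real n}. ennreal (c * r powr (- 1 / q)) \<partial>lborel)"
  proof -
    have "(\<integral>\<^sup>+r. \<Phi> r \<partial>lborel) = (\<integral>\<^sup>+r. \<Phi> (1 - r) \<partial>lborel)"
      by (rule nn_integral_lborel_reflect[symmetric]) (unfold \<Phi>_def, measurable)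
    also have "\<dots> = (\<integral>\<^sup>+r\<in>{0..1 / real n}. ennreal (c * r powr (- 1 / q)) \<partial>lborel)"
      unfolding \<Phi>_def by (intro nn_integral_cong) (auto simp: s_def split: split_indicator)
    finally show ?thesis .
  qed
  also have "\<dots> = ennreal (c * ((1 / real n) powr (- 1 / q + 1) / (- 1 / q + 1)))"
  proof (rule nn_integral_interval_has_integral)
    have "((\<lambda>r. r powr (- 1 / q)) has_integral ((1 / real n) powr (- 1 / q + 1) / (- 1 / q + 1))) {0..1 / real n}"
      using q by (intro has_integral_powr_from_0) auto
    then show "((\<lambda>r. c * r powr (- 1 / q)) has_integral c * ((1 / real n) powr (- 1 / q + 1) / (- 1 / q + 1))) {0..1 / real n}"
      by (rule has_integral_mult_right)
  qed (use c in auto)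
  \<comment> \<open>The power of \<open>n\<close> from the interpolation cancels exactly against the
    one from integrating up to \<open>1 / n\<close>; this fixes the width of the annulus.\<close>
  also have "c * ((1 / real n) powr (- 1 / q + 1) / (- 1 / q + 1)) = (2 * pi + 4 * K) / (1 - 1 / q)"
  proof -
    have "real n powr (1 - 1 / q) * (1 / real n) powr (1 - 1 / q) = 1"
      using n by (simp flip: powr_mult)
    then show ?thesis
      by (simp add: c_def mult.assoc)
  qed
  finally show ?thesis
    by (simp add: F_def s_def)
qed

section \<open>The inner disc and the combined estimate\<close>

text \<open>Serves twice: with exponents \<open>2 - q \<le> q\<close> for the second factor on the
  inner disc, and with \<open>q \<le> p\<close> to pass from the norm of exponent \<open>p\<close>
  to means of exponent \<open>q\<close>.\<close>

lemma powr_le_one_plus_powr: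
  fixes x :: real
  assumes "0 \<le> x" "0 \<le> a" "a \<le> b"
  shows "x powr a \<le> 1 + x powr b"
proof (cases "x \<le> 1")
  case True
  then have "x powr a \<le> 1"
    using assms by (intro powr_le1) auto
  then show ?thesis
    by (simp add: add_increasing2)
next
  case False
  then have "x powr a \<le> x powr b"
    using assms by (intro powr_mono) auto
  then show ?thesis
    by simp
qed

lemma circle_integral_one_plus:
  assumes [measurable]: "(\<lambda>t. F (of_real r * cis t)) \<in> borel_measurable borel"
  shows "circle_integral (\<lambda>z. 1 + F z) r = ennreal (2 * pi) + circle_integral F r"
  unfolding circle_integral_def by (simp add: distrib_right nn_integral_add)

text \<open>The arithmetic-geometric mean inequality with weight \<open>l (\<rho> - norm z)\<close> separates the Carleson integral from a
  logarithmically divergent one.\<close>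

lemma inner_disc_bound:
  assumes f: "f holomorphic_on ball 0 1" "\<And>z. z \<in> ball 0 1 \<Longrightarrow> norm (f z) \<le> 1"
    and g: "g holomorphic_on ball 0 1" and q: "1 < q" "q \<le> 2"
    and s: "0 \<le> s" "s < \<rho>" "\<rho> < 1" and l: "0 < l"
    and bg: "\<And>r. 0 \<le> r \<Longrightarrow> r < 1 \<Longrightarrow> circle_integral (\<lambda>z. ennreal (norm (g z) powr q)) r \<le> ennreal K" and K: "0 \<le> K"
  shows "(\<integral>\<^sup>+z\<in>ball 0 s. ennreal (norm (deriv f z * g z)) \<partial>lborel)
    \<le> ennreal (4 * K * l + (2 * pi + K) / l * ln (\<rho> / (\<rho> - s)))"
proof -
  define F1 where "F1 z = ennreal ((\<rho> - norm z) * ((norm (deriv f z))\<^sup>2 * norm (g z) powr q)) * indicator (ball 0 \<rho>) z" for z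
  define F2 where "F2 z = ennreal ((1 + norm (g z) powr q) / (\<rho> - norm z)) * indicator (ball 0 s) z" for z
  have g_cont: "continuous_on (ball 0 1) (\<lambda>z. norm (g z) powr q)"
    using q by (intro continuous_on_norm_powr holomorphic_on_imp_continuous_on[OF g]) auto
  have f'_cont: "continuous_on (ball 0 1) (deriv f)"
    by (intro holomorphic_on_imp_continuous_on holomorphic_deriv f) auto
  have [measurable]: "F1 \<in> borel_measurable borel"
    unfolding F1_def using s
    by (intro measurable_ennreal_indicator_ball continuous_intros continuous_on_subset[OF g_cont] continuous_on_subset[OF f'_cont]) auto
  have [measurable]: "F2 \<in> borel_measurable borel"
    unfolding F2_def using s
    by (intro measurable_ennreal_indicator_ball continuous_intros continuous_on_subset[OF g_cont]) auto
  have F1: "(\<integral>\<^sup>+z. F1 z \<partial>lborel) \<le> ennreal (4 * K)"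
    unfolding F1_def using q s by (intro carleson_embedding f g bg K) auto
  \<comment> \<open>On each circle the numerator integrates to at most \<open>2 * pi + K\<close>,
    which leaves the integral of \<open>1 / (\<rho> - r)\<close> over \<open>{0..s}\<close>, a
    logarithm.\<close>
  have F2: "(\<integral>\<^sup>+z. F2 z \<partial>lborel) \<le> ennreal ((2 * pi + K) * ln (\<rho> / (\<rho> - s)))"
  proof -
    define \<Phi> where "\<Phi> r = ennreal ((2 * pi + K) / (\<rho> - r)) * indicator {0..s} r" for r
    have "(\<integral>\<^sup>+z. F2 z \<partial>lborel) \<le> (\<integral>\<^sup>+r\<in>{0..}. ennreal r * \<Phi> r \<partial>lborel)"
    proof (rule nn_integral_polar_le)
      fix r :: real assume r: "0 \<le> r"
      show "circle_integral F2 r \<le> \<Phi> r"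
      proof (cases "r < s")
        case True
        have "continuous_on UNIV (\<lambda>t. norm (g (of_real r * cis t)) powr q)"
          using True r s by (intro continuous_on_compose2[OF g_cont] continuous_intros) (auto simp: norm_mult)
        then have [measurable]: "(\<lambda>t. norm (g (of_real r * cis t)) powr q) \<in> borel_measurable borel"
          by (rule borel_measurable_continuous_onI)
        have "circle_integral F2 r = (\<integral>\<^sup>+t. ennreal (1 / (\<rho> - r)) * ((1 + ennreal (norm (g (of_real r * cis t)) powr q)) * indicator {0..2*pi} t) \<partial>lborel)"
          unfolding circle_integral_def F2_def
        proof (rule nn_integral_cong)
          fix t
          have "ennreal ((1 + x) / (\<rho> - r)) = ennreal (1 / (\<rho> - r)) * (1 + ennreal x)" if "0 \<le> x" for x
            using that True s by (simp add: divide_inverse mult.commute flip: ennreal_1 ennreal_plus ennreal_mult)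
          then show "ennreal ((1 + norm (g (of_real r * cis t)) powr q) / (\<rho> - norm (of_real r * cis t))) *
              indicator (ball 0 s) (of_real r * cis t) * indicator {0..2 * pi} t =
              ennreal (1 / (\<rho> - r)) * ((1 + ennreal (norm (g (of_real r * cis t)) powr q)) * indicator {0..2*pi} t)"
            using r True by (simp add: norm_mult mult.assoc)
        qed
        also have "\<dots> = ennreal (1 / (\<rho> - r)) * circle_integral (\<lambda>z. 1 + ennreal (norm (g z) powr q)) r"
          unfolding circle_integral_def by (rule nn_integral_cmult) measurable
        also have "\<dots> = ennreal (1 / (\<rho> - r)) * (ennreal (2 * pi) + circle_integral (\<lambda>z. ennreal (norm (g z) powr q)) r)"
          by (subst circle_integral_one_plus) auto
        also have "\<dots> \<le> ennreal (1 / (\<rho> - r)) * (ennreal (2 * pi) + ennreal K)"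
          using True r s by (intro mult_left_mono add_left_mono bg) auto
        also have "\<dots> = ennreal ((2 * pi + K) / (\<rho> - r))"
          using True s K by (simp flip: ennreal_plus ennreal_mult)
        finally show ?thesis
          using True r by (simp add: \<Phi>_def)
      next
        case False
        then show ?thesis
          using r by (simp add: circle_integral_def F2_def norm_mult)
      qed
    qed measurable
    also have "\<dots> \<le> (\<integral>\<^sup>+r\<in>{0..s}. ennreal ((2 * pi + K) / (\<rho> - r)) \<partial>lborel)"
    proof (rule nn_integral_mono)
      fix r
      have "ennreal r * \<Phi> r \<le> 1 * \<Phi> r" if "r \<le> 1"
        using that by (intro mult_right_mono) auto
      then show "ennreal r * \<Phi> r * indicator {0..} r \<le> ennreal ((2 * pi + K) / (\<rho> - r)) * indicator {0..s} r"
        using s by (cases "r \<le> 1") (auto simp: \<Phi>_def split: split_indicator)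
    qed
    also have "\<dots> = ennreal (- (2 * pi + K) * ln (\<rho> - s) - (- (2 * pi + K) * ln (\<rho> - 0)))"
    proof (rule nn_integral_FTC_Icc)
      show "(\<lambda>r. (2 * pi + K) / (\<rho> - r)) \<in> borel_measurable borel"
        by measurable
      fix r assume r: "r \<in> {0..s}"
      have "((\<lambda>r. - M * ln (\<rho> - r)) has_real_derivative M / (\<rho> - r)) (at r)" for M
        using r s by (auto intro!: derivative_eq_intros)
      then show "((\<lambda>r. - (2 * pi + K) * ln (\<rho> - r)) has_real_derivative (2 * pi + K) / (\<rho> - r)) (at r)" .
      show "0 \<le> (2 * pi + K) / (\<rho> - r)"
        using r s K by (intro divide_nonneg_nonneg) auto
    qed (use s in auto)
    also have "- (2 * pi + K) * ln (\<rho> - s) - (- (2 * pi + K) * ln (\<rho> - 0)) = (2 * pi + K) * ln (\<rho> / (\<rho> - s))"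
      using s by (simp add: ln_div algebra_simps)
    finally show ?thesis .
  qed
  have "(\<integral>\<^sup>+z\<in>ball 0 s. ennreal (norm (deriv f z * g z)) \<partial>lborel) \<le> (\<integral>\<^sup>+z. ennreal l * F1 z + ennreal (1 / l) * F2 z \<partial>lborel)"
  proof (rule nn_integral_mono)
    fix z :: complex
    show "ennreal (norm (deriv f z * g z)) * indicator (ball 0 s) z \<le> ennreal l * F1 z + ennreal (1 / l) * F2 z"
    proof (cases "z \<in> ball 0 s")
      case True
      define w where "w = \<rho> - norm z"
      define x where "x = norm (g z)"
      have w: "0 < w"
        using True s by (simp add: w_def)
      define A where "A = l * (w * ((norm (deriv f z))\<^sup>2 * x powr q))"
      define B where "B = 1 / l * ((1 + x powr q) / w)"
      have AB: "0 \<le> A" "0 \<le> B"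
        using w l by (auto simp: A_def B_def intro!: mult_nonneg_nonneg divide_nonneg_nonneg)
      have x2: "x\<^sup>2 = x powr q * x powr (2 - q)"
      proof -
        have "x powr q * x powr (2 - q) = x powr 2"
          unfolding powr_add[symmetric] by simp
        then show ?thesis
          by (simp add: x_def)
      qed
      \<comment> \<open>The square of the integrand is bounded by \<open>A * B\<close>, in which the
        weights \<open>l\<close> and \<open>w\<close> cancel; the cruder
        \<open>A * B \<le> (A + B)^2\<close> then does the work of the mean inequality.\<close>
      have "(norm (deriv f z) * x)\<^sup>2 = (norm (deriv f z))\<^sup>2 * x powr q * x powr (2 - q)"
        by (simp add: power_mult_distrib x2)
      also have "\<dots> \<le> (norm (deriv f z))\<^sup>2 * x powr q * (1 + x powr q)"
        using q by (intro mult_left_mono powr_le_one_plus_powr) (auto simp: x_def)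
      also have "\<dots> = A * B"
        using w l by (simp add: A_def B_def)
      also have "\<dots> \<le> (A + B)\<^sup>2"
        using AB by (simp add: power2_eq_square algebra_simps)
      finally have "norm (deriv f z) * x \<le> A + B"
        by (rule power2_le_imp_le) (use AB in auto)
      then have "ennreal (norm (deriv f z * g z)) \<le> ennreal (A + B)"
        by (simp add: norm_mult x_def ennreal_leI)
      also have "\<dots> = ennreal l * F1 z + ennreal (1 / l) * F2 z"
      proof -
        have "z \<in> ball 0 \<rho>"
          using True s by auto
        then have "ennreal A = ennreal l * F1 z"
          using l unfolding A_def F1_def w_def x_def by (subst ennreal_mult') auto
        moreover have "ennreal B = ennreal (1 / l) * F2 z"
          using l True unfolding B_def F2_def w_def x_def by (subst ennreal_mult') auto
        ultimately show ?thesis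
          using AB by simp
      qed
      finally show ?thesis
        using True by simp
    qed simp
  qed
  also have "\<dots> = ennreal l * (\<integral>\<^sup>+z. F1 z \<partial>lborel) + ennreal (1 / l) * (\<integral>\<^sup>+z. F2 z \<partial>lborel)"
    by (simp add: nn_integral_add nn_integral_cmult)
  also have "\<dots> \<le> ennreal l * ennreal (4 * K) + ennreal (1 / l) * ennreal ((2 * pi + K) * ln (\<rho> / (\<rho> - s)))"
    by (intro add_mono mult_left_mono F1 F2) auto
  also have "\<dots> = ennreal (4 * K * l + (2 * pi + K) / l * ln (\<rho> / (\<rho> - s)))"
  proof -
    have "0 \<le> ln (\<rho> / (\<rho> - s))"
      using s by (intro ln_ge_zero) auto
    then show ?thesis
      using l K by (simp add: mult_ac flip: ennreal_plus ennreal_mult)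
  qed
  finally show ?thesis .
qed

text \<open>The weight \<open>l = sqrt L\<close> balances \<open>4 * K * l\<close> against a
  multiple of \<open>L / l\<close>, and \<open>4 * K + 2 * (2 * pi + K)\<close> is the
  \<open>6 * K + 4 * pi\<close> of the statement. The bounded outer part is absorbed through
  \<open>ln 2 \<le> L\<close>, whence the division by \<open>sqrt (ln 2)\<close>.\<close>

lemma normalised_area_bound:
  fixes q K :: real
  assumes q: "1 < q" "q \<le> 2" and K: "0 \<le> K"
    and B: "finite_blaschke n B" and n: "0 < n" and g: "g holomorphic_on ball 0 1"
    and bg: "\<And>r. 0 \<le> r \<Longrightarrow> r < 1 \<Longrightarrow> circle_integral (\<lambda>z. ennreal (norm (g z) powr q)) r \<le> ennreal K"
  shows "(\<integral>\<^sup>+z\<in>ball 0 1. ennreal (norm (deriv B z * g z)) \<partial>lborel)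
    \<le> ennreal ((6 * K + 4 * pi + (2 * pi + 4 * K) / (1 - 1 / q) / sqrt (ln 2)) * sqrt (ln (real n + 1)))"
proof -
  note B_props = finite_blaschke_bounds[OF B]
  define L where "L = ln (real n + 1)"
  define s where "s = 1 - 1 / real n"
  \<comment> \<open>Midway between \<open>s\<close> and 1, so
    \<open>\<rho> - s = 1 / (2 * n)\<close> and the logarithm's argument becomes
    \<open>2 * n - 1\<close>.\<close>
  define \<rho> where "\<rho> = 1 - 1 / (2 * real n)"
  have L2: "ln 2 \<le> L"
    using n by (simp add: L_def)
  have L: "0 < L"
    using L2 ln_gt_zero[of 2] by linarith
  have s: "0 \<le> s" "s < \<rho>" "\<rho> < 1"
    using n by (auto simp: s_def \<rho>_def field_simps)
  have ln_le: "ln (\<rho> / (\<rho> - s)) \<le> 2 * L"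
  proof -
    have "\<rho> / (\<rho> - s) = 2 * real n - 1"
      using n by (simp add: s_def \<rho>_def field_simps)
    also have "\<dots> \<le> (real n + 1)\<^sup>2"
      by (simp add: power2_eq_square algebra_simps)
    finally have "ln (\<rho> / (\<rho> - s)) \<le> ln ((real n + 1)\<^sup>2)"
      using s by (intro ln_mono) auto
    then show ?thesis
      by (simp add: L_def ln_realpow)
  qed
  have "(\<integral>\<^sup>+z\<in>ball 0 s. ennreal (norm (deriv B z * g z)) \<partial>lborel)
      \<le> ennreal (4 * K * sqrt L + (2 * pi + K) / sqrt L * ln (\<rho> / (\<rho> - s)))"
    by (rule inner_disc_bound[OF B_props(1,2) g q s _ bg K]) (use L in auto)
  also have "\<dots> \<le> ennreal ((6 * K + 4 * pi) * sqrt L)"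
  proof (rule ennreal_leI)
    have "(2 * pi + K) / sqrt L * ln (\<rho> / (\<rho> - s)) \<le> (2 * pi + K) / sqrt L * (2 * L)"
      using L K by (intro mult_left_mono ln_le) auto
    also have "\<dots> = (4 * pi + 2 * K) * (L / sqrt L)"
      by (simp add: algebra_simps add_divide_distrib)
    also have "L / sqrt L = sqrt L"
      using L by (simp add: real_div_sqrt)
    finally show "4 * K * sqrt L + (2 * pi + K) / sqrt L * ln (\<rho> / (\<rho> - s)) \<le> (6 * K + 4 * pi) * sqrt L"
      by (simp add: algebra_simps)
  qed
  finally have inner: "(\<integral>\<^sup>+z\<in>ball 0 s. ennreal (norm (deriv B z * g z)) \<partial>lborel) \<le> ennreal ((6 * K + 4 * pi) * sqrt L)" .
  define D where "D = (2 * pi + 4 * K) / (1 - 1 / q)"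
  have D: "0 \<le> D"
    using q K by (simp add: D_def)
  have "(\<integral>\<^sup>+z\<in>ball 0 1 - ball 0 s. ennreal (norm (deriv B z * g z)) \<partial>lborel) \<le> ennreal D"
    unfolding s_def D_def by (intro outer_annulus_bound B_props g q n bg K)
  also have "D \<le> D / sqrt (ln 2) * sqrt L"
  proof -
    have "D * 1 \<le> D * (sqrt L / sqrt (ln 2))"
      using L2 D by (intro mult_left_mono) auto
    then show ?thesis
      by simp
  qed
  finally have outer: "(\<integral>\<^sup>+z\<in>ball 0 1 - ball 0 s. ennreal (norm (deriv B z * g z)) \<partial>lborel) \<le> ennreal (D / sqrt (ln 2) * sqrt L)"
    by (simp add: ennreal_leI)
  define F where "F z = ennreal (norm (deriv B z * g z)) * indicator (ball 0 1) z" for z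
  have [measurable]: "F \<in> borel_measurable borel"
    unfolding F_def by (rule measurable_deriv_mult_ball[OF B_props(1) g])
  have sub: "ball 0 s \<subseteq> ball (0::complex) 1"
    using s by auto
  have [measurable]: "ball (0::complex) s \<in> sets borel"
    by simp
  have "(\<integral>\<^sup>+z. F z \<partial>lborel) = (\<integral>\<^sup>+z. F z * indicator (ball 0 s) z + F z * indicator (- ball 0 s) z \<partial>lborel)"
    by (intro nn_integral_cong) (auto split: split_indicator)
  also have "\<dots> = (\<integral>\<^sup>+z. F z * indicator (ball 0 s) z \<partial>lborel) + (\<integral>\<^sup>+z. F z * indicator (- ball 0 s) z \<partial>lborel)"
    by (rule nn_integral_add) measurable
  also have "(\<integral>\<^sup>+z. F z * indicator (ball 0 s) z \<partial>lborel) = (\<integral>\<^sup>+z\<in>ball 0 s. ennreal (norm (deriv B z * g z)) \<partial>lborel)"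
    using sub unfolding F_def by (intro nn_integral_cong) (auto split: split_indicator)
  also have "(\<integral>\<^sup>+z. F z * indicator (- ball 0 s) z \<partial>lborel) = (\<integral>\<^sup>+z\<in>ball 0 1 - ball 0 s. ennreal (norm (deriv B z * g z)) \<partial>lborel)"
    unfolding F_def by (intro nn_integral_cong) (auto split: split_indicator)
  also have "(\<integral>\<^sup>+z\<in>ball 0 s. ennreal (norm (deriv B z * g z)) \<partial>lborel) + \<dots>
      \<le> ennreal ((6 * K + 4 * pi) * sqrt L) + ennreal (D / sqrt (ln 2) * sqrt L)"
    by (intro add_mono inner outer)
  also have "\<dots> = ennreal ((6 * K + 4 * pi + D / sqrt (ln 2)) * sqrt L)"
    using K D L by (simp add: distrib_right flip: ennreal_plus)
  finally show ?thesis
    by (simp add: F_def D_def L_def)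
qed

section \<open>From circle integrals to the Hardy norm\<close>

text \<open>The integrand is continuous on a compact interval, so the Bochner integral in
  \<open>hardy_mean\<close> agrees with the \<open>ennreal\<close> one; raising the mean to the
  power \<open>p\<close> undoes its outer root.\<close>

lemma circle_integral_le_of_hardy_norm_less:
  assumes p: "1 < p" and g: "g \<in> hardy_space p" and N: "hardy_norm p g < N" and r: "0 \<le> r" "r < 1"
  shows "circle_integral (\<lambda>z. ennreal (norm (g z) powr p)) r \<le> ennreal (2 * pi * N powr p)"
proof -
  define I where "I = (LINT t:{0..2*pi}|lborel. norm (g (of_real r * cis t)) powr p)"
  have hol: "g holomorphic_on ball 0 1" and bdd: "bdd_above (hardy_mean p g ` {0..<1})"
    using g by (auto simp: hardy_space_def)
  have cont: "continuous_on {0..2*pi} (\<lambda>t. norm (g (of_real r * cis t)) powr p)"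
    using p r
    by (intro continuous_on_norm_powr continuous_on_compose2[OF holomorphic_on_imp_continuous_on[OF hol]] continuous_intros)
       (auto simp: norm_mult)
  then have int: "set_integrable lborel {0..2*pi} (\<lambda>t. norm (g (of_real r * cis t)) powr p)"
    by (rule borel_integrable_atLeastAtMost')
  have "circle_integral (\<lambda>z. ennreal (norm (g z) powr p)) r = (\<integral>\<^sup>+t. ennreal (indicator {0..2*pi} t *\<^sub>R norm (g (of_real r * cis t)) powr p) \<partial>lborel)"
    unfolding circle_integral_def by (intro nn_integral_cong) (auto split: split_indicator)
  also have "\<dots> = ennreal I"
    unfolding I_def set_lebesgue_integral_def using int unfolding set_integrable_def
    by (intro nn_integral_eq_integral) auto
  finally have circle_integral_I: "circle_integral (\<lambda>z. ennreal (norm (g z) powr p)) r = ennreal I" .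
  have I0: "0 \<le> I"
    unfolding I_def set_lebesgue_integral_def by (intro integral_nonneg_AE) auto
  have "hardy_mean p g r \<le> hardy_norm p g"
    unfolding hardy_norm_def using bdd r by (intro cSUP_upper) auto
  then have "(1 / (2 * pi) * I) powr (1 / p) \<le> N"
    using N by (simp add: hardy_mean_def I_def)
  then have "((1 / (2 * pi) * I) powr (1 / p)) powr p \<le> N powr p"
    using p by (intro powr_mono2) auto
  then have "1 / (2 * pi) * I \<le> N powr p"
    using p I0 by (simp add: powr_powr)
  then have "I \<le> 2 * pi * N powr p"
    by (simp add: field_simps)
  then show ?thesis
    by (simp add: circle_integral_I ennreal_leI)
qed

lemma hardy_norm_nonneg:
  assumes "g \<in> hardy_space p"
  shows "0 \<le> hardy_norm p g"
proof -
  have "0 \<le> hardy_mean p g 0"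
    by (simp add: hardy_mean_def)
  also have "\<dots> \<le> hardy_norm p g"
    unfolding hardy_norm_def using assms by (intro cSUP_upper) (auto simp: hardy_space_def)
  finally show ?thesis .
qed

text \<open>Any \<open>N\<close> above the norm is used in place of the norm, so that dividing by it is harmless even
  for \<open>g = 0\<close>.\<close>

lemma area_bound_hardy_norm_less:
  fixes p :: real
  assumes p: "1 < p" and B: "finite_blaschke n B" and n: "0 < n" and g: "g \<in> hardy_space p"
    and N: "hardy_norm p g < N"
  defines "q \<equiv> min p 2"
  shows "(\<integral>\<^sup>+z\<in>ball 0 1. ennreal (norm (deriv B z * g z)) \<partial>lborel)
    \<le> ennreal ((28 * pi + 18 * pi / (1 - 1 / q) / sqrt (ln 2)) * sqrt (ln (real n + 1)) * N)"
proof -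
  have hol: "g holomorphic_on ball 0 1"
    using g by (simp add: hardy_space_def)
  have N0: "0 < N"
    using hardy_norm_nonneg[OF g] N by linarith
  have q: "1 < q" "q \<le> 2" "q \<le> p"
    using p by (auto simp: q_def)
  define h where "h z = g z / of_real N" for z
  have h: "h holomorphic_on ball 0 1"
    unfolding h_def using N0 by (intro holomorphic_intros hol) auto
  \<comment> \<open>One \<open>2 * pi\<close> comes from the constant 1, the other from the
    normalised mean of exponent \<open>p\<close>. With \<open>K = 4 * pi\<close> the constants
    become \<open>6 * K + 4 * pi = 28 * pi\<close> and
    \<open>2 * pi + 4 * K = 18 * pi\<close>.\<close>
  have "circle_integral (\<lambda>z. ennreal (norm (h z) powr q)) r \<le> ennreal (4 * pi)" if r: "0 \<le> r" "r < 1" for r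
  proof -
    have "continuous_on UNIV (\<lambda>t. norm (g (of_real r * cis t)) powr p)"
      using p r
      by (intro continuous_on_norm_powr continuous_on_compose2[OF holomorphic_on_imp_continuous_on[OF hol]] continuous_intros)
         (auto simp: norm_mult)
    then have [measurable]: "(\<lambda>t. norm (g (of_real r * cis t)) powr p) \<in> borel_measurable borel"
      by (rule borel_measurable_continuous_onI)
    have "circle_integral (\<lambda>z. ennreal (norm (h z) powr q)) r \<le> circle_integral (\<lambda>z. 1 + ennreal (1 / N powr p) * ennreal (norm (g z) powr p)) r"
      unfolding circle_integral_def
    proof (intro nn_integral_mono mult_right_mono)
      fix t
      define x where "x = norm (g (of_real r * cis t))"
      have "norm (h (of_real r * cis t)) powr q \<le> 1 + norm (h (of_real r * cis t)) powr p"
        using q by (intro powr_le_one_plus_powr) auto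
      also have "norm (h (of_real r * cis t)) powr p = 1 / N powr p * x powr p"
        using N0 by (simp add: h_def x_def norm_divide powr_divide)
      finally have "ennreal (norm (h (of_real r * cis t)) powr q) \<le> ennreal (1 + 1 / N powr p * x powr p)"
        by (rule ennreal_leI)
      then show "ennreal (norm (h (of_real r * cis t)) powr q) \<le> 1 + ennreal (1 / N powr p) * ennreal (norm (g (of_real r * cis t)) powr p)"
        by (simp add: x_def flip: ennreal_mult)
    qed simp
    also have "\<dots> = ennreal (2 * pi) + ennreal (1 / N powr p) * circle_integral (\<lambda>z. ennreal (norm (g z) powr p)) r"
      by (subst circle_integral_one_plus) (auto simp: circle_integral_def nn_integral_cmult mult.assoc)
    also have "\<dots> \<le> ennreal (2 * pi) + ennreal (1 / N powr p) * ennreal (2 * pi * N powr p)"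
      by (intro add_left_mono mult_left_mono circle_integral_le_of_hardy_norm_less p g N r) auto
    also have "\<dots> = ennreal (4 * pi)"
      using N0 by (simp flip: ennreal_plus ennreal_mult)
    finally show ?thesis .
  qed
  from normalised_area_bound[OF q(1,2) _ B n h this]
  have "(\<integral>\<^sup>+z\<in>ball 0 1. ennreal (norm (deriv B z * h z)) \<partial>lborel)
      \<le> ennreal ((28 * pi + 18 * pi / (1 - 1 / q) / sqrt (ln 2)) * sqrt (ln (real n + 1)))"
    by simp
  moreover have "(\<integral>\<^sup>+z\<in>ball 0 1. ennreal (norm (deriv B z * g z)) \<partial>lborel)
      = ennreal N * (\<integral>\<^sup>+z\<in>ball 0 1. ennreal (norm (deriv B z * h z)) \<partial>lborel)"
  proof -
    have "ennreal (norm (deriv B z * g z)) = ennreal N * ennreal (norm (deriv B z * h z))" for z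
      using N0 by (simp add: h_def norm_mult norm_divide flip: ennreal_mult)
    then have "(\<integral>\<^sup>+z\<in>ball 0 1. ennreal (norm (deriv B z * g z)) \<partial>lborel)
        = (\<integral>\<^sup>+z. ennreal N * (ennreal (norm (deriv B z * h z)) * indicator (ball 0 1) z) \<partial>lborel)"
      by (simp add: mult.assoc)
    also have "\<dots> = ennreal N * (\<integral>\<^sup>+z\<in>ball 0 1. ennreal (norm (deriv B z * h z)) \<partial>lborel)"
      using measurable_deriv_mult_ball[OF finite_blaschke_bounds(1)[OF B] h] by (intro nn_integral_cmult) simp
    finally show ?thesis .
  qed
  ultimately have "(\<integral>\<^sup>+z\<in>ball 0 1. ennreal (norm (deriv B z * g z)) \<partial>lborel)
      \<le> ennreal N * ennreal ((28 * pi + 18 * pi / (1 - 1 / q) / sqrt (ln 2)) * sqrt (ln (real n + 1)))"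
    by (simp add: mult_left_mono)
  then show ?thesis
    using N0 by (simp add: mult.commute flip: ennreal_mult')
qed

theorem theorem1p5:
  fixes p :: real
  assumes "1 < p"
  shows "\<exists>C::real. \<forall>(n::nat) (B::complex \<Rightarrow> complex) (g::complex \<Rightarrow> complex).
           finite_blaschke n B \<longrightarrow> g \<in> hardy_space p \<longrightarrow>
           (\<integral>\<^sup>+z\<in>ball 0 1. ennreal (norm (deriv B z * g z)) \<partial>lborel)
             \<le> ennreal (C * sqrt (ln (real n + 1)) * hardy_norm p g)"
proof (intro exI allI impI)
  fix n B g assume B: "finite_blaschke n B" and g: "g \<in> hardy_space p"
  define C where "C = 28 * pi + 18 * pi / (1 - 1 / min p 2) / sqrt (ln 2)"
  have "0 \<le> 18 * pi / (1 - 1 / min p 2) / sqrt (ln 2)"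
    using assms by (intro divide_nonneg_nonneg) (auto simp: min_def)
  then have C: "0 < C"
    unfolding C_def using pi_gt_zero by linarith
  show "(\<integral>\<^sup>+z\<in>ball 0 1. ennreal (norm (deriv B z * g z)) \<partial>lborel)
    \<le> ennreal ((28 * pi + 18 * pi / (1 - 1 / min p 2) / sqrt (ln 2)) * sqrt (ln (real n + 1)) * hardy_norm p g)"
    unfolding C_def[symmetric]
  proof (cases "n = 0")
    \<comment> \<open>Here the right side is 0 because \<open>ln 1 = 0\<close>, and the left side
      vanishes because an empty product makes \<open>B\<close> constant on the disc.\<close>
    case True
    then obtain c where c: "\<And>z. z \<in> ball 0 1 \<Longrightarrow> B z = c"
      using B unfolding finite_blaschke_def by auto
    have "deriv B z = 0" if "z \<in> ball 0 1" for z
    proof -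
      have "(B has_field_derivative 0) (at z)"
        by (rule has_field_derivative_transform_within_open[OF DERIV_const[of c] open_ball that]) (simp add: c)
      then show ?thesis
        by (rule DERIV_imp_deriv)
    qed
    then have "(\<integral>\<^sup>+z\<in>ball 0 1. ennreal (norm (deriv B z * g z)) \<partial>lborel) = (\<integral>\<^sup>+(z::complex). 0 \<partial>lborel)"
      by (intro nn_integral_cong) (auto split: split_indicator)
    then show "(\<integral>\<^sup>+z\<in>ball 0 1. ennreal (norm (deriv B z * g z)) \<partial>lborel) \<le> ennreal (C * sqrt (ln (real n + 1)) * hardy_norm p g)"
      by simp
  next
    case False
    define A where "A = C * sqrt (ln (real n + 1))"
    have A: "0 < A"
      using C False by (simp add: A_def)
    show "(\<integral>\<^sup>+z\<in>ball 0 1. ennreal (norm (deriv B z * g z)) \<partial>lborel) \<le> ennreal (C * sqrt (ln (real n + 1)) * hardy_norm p g)"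
    \<comment> \<open>Taking \<open>hardy_norm p g + e / A\<close> as the number above the norm
      costs exactly \<open>e\<close>; for \<open>n > 0\<close> the factor \<open>A\<close> is
      positive, so the division is legitimate.\<close>
    proof (rule ennreal_le_epsilon)
      fix e :: real assume e: "0 < e"
      have "(\<integral>\<^sup>+z\<in>ball 0 1. ennreal (norm (deriv B z * g z)) \<partial>lborel) \<le> ennreal (A * (hardy_norm p g + e / A))"
        unfolding A_def C_def using False A e unfolding A_def C_def
        by (intro area_bound_hardy_norm_less assms B g) auto
      also have "A * (hardy_norm p g + e / A) = A * hardy_norm p g + e"
        using A by (simp add: algebra_simps)
      also have "ennreal \<dots> = ennreal (A * hardy_norm p g) + ennreal e"
        using A e hardy_norm_nonneg[OF g] by simp
      finally show "(\<integral>\<^sup>+z\<in>ball 0 1. ennreal (norm (deriv B z * g z)) \<partial>lborel)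
          \<le> ennreal (C * sqrt (ln (real n + 1)) * hardy_norm p g) + ennreal e"
        by (simp add: A_def)
    qed
  qed
qed

end
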